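(* Let $p\in(0,1)$, $\eta,\beta_l,\beta_e>0$, $\lambda_l,\lambda_e\ge 0$ with $\lambda_l p\beta_l^2+\lambda_e\beta_e^2>0$. Consider the network of legitimate nodes and eavesdroppers distributed as independent Poisson point processes in $\mathbb{R}^2$ with densities $\lambda_l$ and $\lambda_e$, the legitimate nodes employing slotted ALOHA with transmission probability $p$, at a fixed time slot. Place a transmitting legitimate node at the origin $0$ (typical node), and let $$N_{t,0}=\sum_{x\in\Phi_r}\mathbf{1}\{0\stackrel{(1)}{\rightarrow}x\}\,\mathbf{1}\{\text{no eavesdropper in }\mathbb{B}(0,\beta_e\|x\|)\}$$ be its secure out-degree. Then $$\mathbb{E}N_{t,0}=\frac{\lambda_l(1-p)\left[1-\exp\left(-(\lambda_l p\beta_l^2+\lambda_e\beta_e^2)\pi\eta^2\right)\right]}{\lambda_l p\beta_l^2+\lambda_e\beta_e^2}.$$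
   Context: $\mathbb{B}(x,r)$ denotes the disk in $\mathbb{R}^2$ centred at $x$ of radius $r$; $\|\cdot\|$ is the Euclidean norm. Legitimate nodes $\Phi_l$ and eavesdroppers $\Phi_e$ are independent homogeneous Poisson point processes on $\mathbb{R}^2$ with densities $\lambda_l$ and $\lambda_e$. In a given slot each legitimate node independently transmits with probability $p$ (set $\Phi_t$) and otherwise receives (set $\Phi_r=\Phi_l\setminus\Phi_t$). For a transmitter $x$ and a receiver $y$, $\mathbf{1}\{x\stackrel{(1)}{\rightarrow}y\}=1$ (single-hop connectivity without the security constraint) if and only if (C1) $\|x-y\|<\eta$ and (C2) the disk $\mathbb{B}(y,\beta_l\|x-y\|)$ contains no transmitting node other than $x$. The expectation is for a typical node: a transmitting node is added at the origin to the Poisson process $\Phi_l$. *)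

theory Defs
  imports "HOL-Probability.Probability"
begin

definition locally_finite_set :: "'a::metric_space set \<Rightarrow> bool" where
  "locally_finite_set S \<longleftrightarrow> (\<forall>A. bounded A \<longrightarrow> finite (S \<inter> A))"

text \<open>The measurable space of locally finite point configurations, generated by the counts of
  points in bounded Borel sets. A simple point process is a random variable with values in it.\<close>

definition config_space :: "'a::euclidean_space set measure" where
  "config_space = sigma {S. locally_finite_set S}
     {{S. locally_finite_set S \<and> card (S \<inter> A) = k} | A k. A \<in> sets borel \<and> bounded A}"

text \<open>The Poisson probabilities are written out because \<^const>\<open>poisson_pmf\<close> is only
  meaningful for a positive rate, whereas the intensity \<open>\<rho>\<close> and the volume of \<open>A\<close>
  may be zero here (then \<open>0 ^ 0 = 1\<close> gives the point mass at zero).\<close>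

definition poisson_point_process ::
    "'w measure \<Rightarrow> real \<Rightarrow> ('w \<Rightarrow> 'a::euclidean_space set) \<Rightarrow> bool" where
  "poisson_point_process M \<rho> \<Phi> \<longleftrightarrow>
     \<Phi> \<in> measurable M config_space \<and>
     (\<forall>A k. A \<in> sets borel \<longrightarrow> bounded A \<longrightarrow>
        measure M {\<omega> \<in> space M. card (\<Phi> \<omega> \<inter> A) = k} =
          (\<rho> * measure lborel A) ^ k / fact k * exp (- (\<rho> * measure lborel A))) \<and>
     (\<forall>(n::nat) A. (\<forall>i<n. A i \<in> sets borel \<and> bounded (A i)) \<longrightarrow>
        disjoint_family_on A {..<n} \<longrightarrow>
        prob_space.indep_vars M (\<lambda>_. count_space UNIV) (\<lambda>i \<omega>. card (\<Phi> \<omega> \<inter> A i)) {..<n})"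

text \<open>A measurable enumeration without repetition of the points of \<open>\<Phi>\<close>; the number \<open>K\<close> of
  points may be infinite, and the values of \<open>X n\<close> for \<open>n \<ge> K\<close> are irrelevant.\<close>

definition enumerates ::
    "'w measure \<Rightarrow> ('w \<Rightarrow> 'a::euclidean_space set) \<Rightarrow> ('w \<Rightarrow> enat) \<Rightarrow> (nat \<Rightarrow> 'w \<Rightarrow> 'a) \<Rightarrow> bool" where
  "enumerates M \<Phi> K X \<longleftrightarrow>
     K \<in> measurable M (count_space UNIV) \<and>
     (\<forall>n. X n \<in> borel_measurable M) \<and>
     (\<forall>\<omega>\<in>space M. bij_betw (\<lambda>n. X n \<omega>) {n. enat n < K \<omega>} (\<Phi> \<omega>))"

text \<open>Independence of two random elements, as in \<^const>\<open>prob_space.indep_var\<close>, which however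
  requires both of them to take values in the same type.\<close>

definition indep_elements ::
    "'w measure \<Rightarrow> 'b measure \<Rightarrow> ('w \<Rightarrow> 'b) \<Rightarrow> 'c measure \<Rightarrow> ('w \<Rightarrow> 'c) \<Rightarrow> bool" where
  "indep_elements M N X N' Y \<longleftrightarrow>
     X \<in> measurable M N \<and> Y \<in> measurable M N' \<and>
     prob_space.indep_set M {X -` A \<inter> space M | A. A \<in> sets N}
                            {Y -` A \<inter> space M | A. A \<in> sets N'}"

text \<open>\<open>\<Psi>\<close> consists of the points of \<open>\<Phi>\<close> that are retained when each point is kept
  independently with probability \<open>p\<close>: the \<open>n\<close>-th point is kept iff its mark \<open>B n\<close> is true. The
  marks are i.i.d. and independent of everything else, that is, of the (enumerated) points
  of \<open>\<Phi>\<close> and of the further random element \<open>Y\<close>, jointly.\<close>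

definition independent_thinning ::
    "'w measure \<Rightarrow> real \<Rightarrow> ('w \<Rightarrow> 'a::euclidean_space set) \<Rightarrow> 'b measure \<Rightarrow> ('w \<Rightarrow> 'b) \<Rightarrow>
     ('w \<Rightarrow> 'a set) \<Rightarrow> bool" where
  "independent_thinning M p \<Phi> N Y \<Psi> \<longleftrightarrow>
     (\<exists>K X (B :: nat \<Rightarrow> 'w \<Rightarrow> bool).
        enumerates M \<Phi> K X \<and>
        prob_space.indep_vars M (\<lambda>_. count_space UNIV) B UNIV \<and>
        (\<forall>n. measure M {\<omega> \<in> space M. B n \<omega>} = p) \<and>
        indep_elements M
          (\<Pi>\<^sub>M n\<in>UNIV. count_space UNIV) (\<lambda>\<omega> n. B n \<omega>)
          (count_space UNIV \<Otimes>\<^sub>M (\<Pi>\<^sub>M n\<in>UNIV. borel) \<Otimes>\<^sub>M N) (\<lambda>\<omega>. (K \<omega>, (\<lambda>n. X n \<omega>), Y \<omega>)) \<and>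
        (\<forall>\<omega>\<in>space M. \<Psi> \<omega> = {X n \<omega> | n. enat n < K \<omega> \<and> B n \<omega>}))"

text \<open>Here \<open>T\<close> is the set of all transmitting nodes, \<open>x\<close> the transmitter and \<open>y\<close> the receiver.\<close>

definition single_hop ::
    "real \<Rightarrow> real \<Rightarrow> (real ^ 2) set \<Rightarrow> real ^ 2 \<Rightarrow> real ^ 2 \<Rightarrow> bool" where
  "single_hop \<eta> \<beta>\<^sub>l T x y \<longleftrightarrow>
     norm (x - y) < \<eta> \<and> (T - {x}) \<inter> ball y (\<beta>\<^sub>l * norm (x - y)) = {}"

text \<open>Secure out-degree of a transmitting node added at the origin, where \<open>T\<close>, \<open>R\<close>, \<open>E\<close> are the
  transmitting nodes, receiving nodes and eavesdroppers. For a locally finite \<open>R\<close> only finitely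
  many summands are nonzero, as those with \<open>norm x \<ge> \<eta>\<close> vanish.\<close>

definition secure_out_degree ::
    "real \<Rightarrow> real \<Rightarrow> real \<Rightarrow> (real ^ 2) set \<Rightarrow> (real ^ 2) set \<Rightarrow> (real ^ 2) set \<Rightarrow> real" where
  "secure_out_degree \<eta> \<beta>\<^sub>l \<beta>\<^sub>e T R E =
     (\<Sum>\<^sub>\<infinity>x\<in>R. of_bool (single_hop \<eta> \<beta>\<^sub>l (insert 0 T) 0 x) *
             of_bool (E \<inter> ball 0 (\<beta>\<^sub>e * norm x) = {}))"

end

theory Submission
  imports Defs
begin

text \<open>
  Conditionally on the points and the eavesdroppers, the marks are i.i.d., so averaging over them
  turns the event that no point of \<open>\<Phi>\<^sub>l\<close> in the disk around a receiver \<open>x\<close> transmits (nor \<open>x\<close> itself)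
  into the weight \<open>(1 - p) ^ k\<close>, where \<open>k\<close> counts \<open>x\<close> and the points of the disk. By Mecke's formula the
  expected sum of these weights is \<open>\<lambda>\<^sub>l (1 - p)\<close> times the integral of \<open>exp (- c \<pi> (norm x)\<^sup>2)\<close> over the disk of
  radius \<open>\<eta>\<close>, where \<open>c = \<lambda>\<^sub>l p \<beta>\<^sub>l\<^sup>2 + \<lambda>\<^sub>e \<beta>\<^sub>e\<^sup>2\<close>. The formula is obtained here by cutting the disk
  into small cells: on each cell the weight is sandwiched between functions of the counts of
  disjoint fixed regions, whose expectations are explicit and differ by a factor \<open>exp (O(\<epsilon>))\<close>.
\<close>

text \<open>The hypotheses on a Poisson process concern counts in finitely many fixed disjoint
  bounded sets, whereas the disk around a receiver moves with the receiver, itself a point of the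
  process. For receivers in one cell of radius \<epsilon> all these disks lie between two fixed
  disks whose areas differ by O(\<epsilon>); this freezes the geometry. Cells with several points
  need no separate estimate. The upper bound forgets the cell's points except the receiver, the
  lower bound lets all of them interfere; with \<open>N\<close> points of mean \<open>m\<close> in
  the cell these choices give \<open>N * q\<close> and \<open>N * q ^ N\<close>, whose means differ
  only by the factor exp (- (1 - q) m), with m = O(\<epsilon>^2). All errors are factors that are
  uniform over the cells, so they survive summation over any number of cells.

  The second obstacle is measurability: sums over random sets and counts in random disks are
  rewritten along the enumeration as series over fixed indices.\<close>

section \<open>Measurable counts, Poisson moments and the radial integral\<close>

lemma space_config_space: "space config_space = {S. locally_finite_set S}"
  unfolding config_space_def by (rule space_measure_of) auto

lemma measurable_card_Int_config_space:
  assumes "A \<in> sets borel" "bounded A"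
  shows "(\<lambda>S. card (S \<inter> A)) \<in> measurable config_space (count_space UNIV)"
proof -
  have "{S. locally_finite_set S \<and> card (S \<inter> A) = k} \<in> sets config_space" for k
    unfolding config_space_def by (subst sets_measure_of) (use assms in \<open>auto intro!: sigma_sets.Basic\<close>)
  then show ?thesis
    by (subst measurable_count_space_eq2_countable)
       (auto simp: space_config_space vimage_def Int_def conj_commute)
qed

text \<open>The generating function of a Poisson variable, and \<open>q\<close> times its
  derivative. The value \<open>q = 0\<close> yields void probabilities, since
  \<open>0 ^ 0 = 1\<close>, and \<open>q = 1\<close> in the second formula yields the mean.\<close>

lemma (in prob_space)
  fixes N :: "'a \<Rightarrow> nat" and m q :: real
  assumes N [measurable]: "N \<in> measurable M (count_space UNIV)"
    and prob_N: "\<And>k. prob {\<omega> \<in> space M. N \<omega> = k} = m ^ k / fact k * exp (- m)"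
    and "0 \<le> m" "0 \<le> q"
  shows nn_integral_power_poisson:
      "(\<integral>\<^sup>+ \<omega>. ennreal (q ^ N \<omega>) \<partial>M) = ennreal (exp (- ((1 - q) * m)))"
    and nn_integral_times_power_poisson:
      "(\<integral>\<^sup>+ \<omega>. ennreal (N \<omega> * q ^ N \<omega>) \<partial>M) = ennreal (q * m * exp (- ((1 - q) * m)))"
proof -
  have D: "distr M (count_space UNIV) N = density (count_space UNIV) (\<lambda>k. ennreal (m ^ k / fact k * exp (- m)))"
  proof (rule measure_eqI_countable)
    fix k
    have "emeasure (distr M (count_space UNIV) N) {k} = ennreal (m ^ k / fact k * exp (- m))"
      using prob_N[of k] by (subst emeasure_distr) (auto simp: vimage_def Int_def emeasure_eq_measure conj_commute)
    then show "emeasure (distr M (count_space UNIV) N) {k} =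
        emeasure (density (count_space UNIV) (\<lambda>k. ennreal (m ^ k / fact k * exp (- m)))) {k}"
      by (simp add: emeasure_density nn_integral_count_space_indicator[symmetric])
  qed auto
  have sum: "(\<integral>\<^sup>+ \<omega>. ennreal (f (N \<omega>)) \<partial>M) = (\<Sum>k. ennreal (m ^ k / fact k * exp (- m) * f k))"
    if "\<And>k. 0 \<le> f k" for f
  proof -
    have "(\<integral>\<^sup>+ \<omega>. ennreal (f (N \<omega>)) \<partial>M) = (\<integral>\<^sup>+ k. ennreal (f k) \<partial>distr M (count_space UNIV) N)"
      by (subst nn_integral_distr) auto
    also have "\<dots> = (\<Sum>k. ennreal (m ^ k / fact k * exp (- m)) * ennreal (f k))"
      unfolding D by (subst nn_integral_density) (auto simp: nn_integral_count_space_nat)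
    also have "\<dots> = (\<Sum>k. ennreal (m ^ k / fact k * exp (- m) * f k))"
      using that \<open>0 \<le> m\<close> by (subst ennreal_mult) auto
    finally show ?thesis .
  qed
  have ex: "exp (- m) * exp (q * m) = exp (- ((1 - q) * m))"
    by (simp add: exp_add[symmetric] algebra_simps)
  have "(\<lambda>k. (q * m) ^ k / fact k) sums exp (q * m)"
    using exp_converges[of "q * m"] by (simp add: divide_inverse mult.commute)
  from sums_mult[OF this, of "exp (- m)"]
  have s1: "(\<lambda>k. m ^ k / fact k * exp (- m) * q ^ k) sums exp (- ((1 - q) * m))"
    unfolding ex by (simp add: power_mult_distrib mult_ac)
  then show "(\<integral>\<^sup>+ \<omega>. ennreal (q ^ N \<omega>) \<partial>M) = ennreal (exp (- ((1 - q) * m)))"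
    using \<open>0 \<le> m\<close> \<open>0 \<le> q\<close> by (subst sum) (auto intro!: suminf_ennreal_eq)
  \<comment> \<open>Multiplication by \<open>q * m\<close> turns the term of index \<open>k\<close>
    of the first series into the term of index \<open>k + 1\<close> of the second. The term of index
    0 vanishes because of the factor \<open>k\<close>, so the shift loses nothing.\<close>
  from sums_mult[OF s1, of "q * m"]
  have "(\<lambda>k. m ^ Suc k / fact (Suc k) * exp (- m) * (Suc k * q ^ Suc k)) sums
      (q * m * exp (- ((1 - q) * m)))"
    by (rule sums_cong[THEN iffD1, rotated]) (simp add: field_simps del: of_nat_Suc)
  then have "(\<lambda>k. m ^ k / fact k * exp (- m) * (k * q ^ k)) sums (q * m * exp (- ((1 - q) * m)))"
    by (subst (asm) sums_Suc_iff) simp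
  then show "(\<integral>\<^sup>+ \<omega>. ennreal (N \<omega> * q ^ N \<omega>) \<partial>M) = ennreal (q * m * exp (- ((1 - q) * m)))"
    using \<open>0 \<le> m\<close> \<open>0 \<le> q\<close> by (subst sum[of "\<lambda>k. k * q ^ k"]) (auto intro!: suminf_ennreal_eq)
qed

text \<open>The squared norm has a constant density under Lebesgue measure in the plane.\<close>
lemma nn_integral_ball_exp_norm_square:
  fixes \<eta> a :: real
  assumes "0 < \<eta>" "0 < a"
  shows "(\<integral>\<^sup>+ x \<in> ball 0 \<eta>. ennreal (exp (- (a * pi * (norm (x :: real ^ 2))\<^sup>2))) \<partial>lborel) =
    ennreal ((1 - exp (- (a * pi * \<eta>\<^sup>2))) / a)"
proof -
  let ?M = "distr (density lborel (indicator (ball 0 \<eta>))) borel (\<lambda>x :: real ^ 2. (norm x)\<^sup>2)"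
  let ?N = "density lborel (\<lambda>t :: real. ennreal pi * indicator {0..\<eta>\<^sup>2} t)"
  have ball: "emeasure lborel (ball (0::real^2) r) = ennreal (pi * r\<^sup>2)" if "0 \<le> r" for r
    using that by (simp add: emeasure_ball unit_ball_vol_2)
  \<comment> \<open>It suffices to compare finite measures on open half-lines. The preimage of
    \<open>{t<..}\<close> in the disk is the whole disk, an annulus or empty, and its area is \<pi>
    times the length of the remaining part of the interval.\<close>
  have eq: "emeasure ?M {t<..} = emeasure ?N {t<..}" for t
  proof -
    have "emeasure ?M {t<..} =
        emeasure (density lborel (indicator (ball (0::real^2) \<eta>))) {x. t < (norm x)\<^sup>2}"
      by (subst emeasure_distr) (simp_all add: vimage_def)
    also have "\<dots> = (\<integral>\<^sup>+ x. indicator (ball 0 \<eta>) x * indicator {x::real^2. t < (norm x)\<^sup>2} x \<partial>lborel)"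
      by (rule emeasure_density[OF borel_measurable_indicator]) simp_all
    also have "\<dots> = emeasure lborel (ball 0 \<eta> \<inter> {x::real^2. t < (norm x)\<^sup>2})"
      by (simp add: indicator_inter_arith[symmetric])
    finally have M: "emeasure ?M {t<..} = \<dots>" .
    have N: "emeasure ?N {t<..} = ennreal pi * emeasure lborel ({0..\<eta>\<^sup>2} \<inter> {t<..})"
      by (simp add: emeasure_density indicator_inter_arith[symmetric] mult.assoc nn_integral_cmult)
    consider "t < 0" | "0 \<le> t" "t < \<eta>\<^sup>2" | "\<eta>\<^sup>2 \<le> t" by linarith
    then show ?thesis
    proof cases
      case 1
      have "(norm x)\<^sup>2 > t" for x :: "real ^ 2"
        using 1 by (meson less_le_trans zero_le_power2)
      moreover have "{0..\<eta>\<^sup>2} \<inter> {t<..} = {0..\<eta>\<^sup>2}" using 1 by auto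
      ultimately show ?thesis
        using \<open>0 < \<eta>\<close> ball[of \<eta>] by (simp add: M N ennreal_mult)
    next
      case 2
      have "sqrt t < \<eta>"
        using 2 \<open>0 < \<eta>\<close> real_sqrt_less_mono[of t "\<eta>\<^sup>2"] by simp
      have lt: "t < (norm x)\<^sup>2 \<longleftrightarrow> sqrt t < norm x" for x :: "real ^ 2"
        by (metis norm_ge_zero real_sqrt_less_iff real_sqrt_unique)
      have "ball 0 \<eta> \<inter> {x::real^2. t < (norm x)\<^sup>2} = ball 0 \<eta> - cball 0 (sqrt t)"
        by (simp add: set_eq_iff lt not_le)
      moreover have "emeasure lborel (cball (0::real^2) (sqrt t)) = ennreal (pi * t)"
        using 2 by (simp add: emeasure_cball unit_ball_vol_2)
      moreover have "{0..\<eta>\<^sup>2} \<inter> {t<..} = {t<..\<eta>\<^sup>2}" using 2 by auto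
      moreover have "cball 0 (sqrt t) \<subseteq> ball (0::real^2) \<eta>" using \<open>sqrt t < \<eta>\<close> by auto
      moreover have "emeasure lborel (ball (0::real^2) \<eta> - cball 0 (sqrt t)) =
          emeasure lborel (ball (0::real^2) \<eta>) - emeasure lborel (cball (0::real^2) (sqrt t))"
        if "cball 0 (sqrt t) \<subseteq> ball (0::real^2) \<eta>"
        by (rule emeasure_Diff) (use that emeasure_lborel_cball_finite[of "0::real^2" "sqrt t"] in \<open>auto simp: less_top\<close>)
      ultimately have "emeasure ?M {t<..} = ennreal (pi * \<eta>\<^sup>2) - ennreal (pi * t)"
        using ball[of \<eta>] \<open>0 < \<eta>\<close> by (simp add: M)
      also have "\<dots> = ennreal (pi * (\<eta>\<^sup>2 - t))"
        using 2 by (simp add: ennreal_minus right_diff_distrib)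
      also have "\<dots> = ennreal pi * ennreal (\<eta>\<^sup>2 - t)"
        using 2 by (simp add: ennreal_mult)
      also have "\<dots> = emeasure ?N {t<..}"
        using 2 \<open>{0..\<eta>\<^sup>2} \<inter> {t<..} = {t<..\<eta>\<^sup>2}\<close> by (simp add: N)
      finally show ?thesis .
    next
      case 3
      have "ball 0 \<eta> \<inter> {x::real^2. t < (norm x)\<^sup>2} = {}"
        using 3 power_strict_mono[of "norm x" \<eta> 2 for x :: "real ^ 2"] by fastforce
      moreover have "emeasure lborel ({0..\<eta>\<^sup>2} \<inter> {t<..}) = 0"
        using 3 by (subst Int_emptyI) auto
      ultimately show ?thesis by (simp add: M N)
    qed
  qed
  have fin: "emeasure ?M {t<..} < \<infinity>" for t
    unfolding eq
    by (rule le_less_trans[OF emeasure_space]) (simp add: emeasure_density nn_integral_cmult ennreal_mult_less_top)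
  have "?M = ?N"
    by (rule measure_eqI_lessThan) (use eq fin in auto)
  have "(\<integral>\<^sup>+ t. ennreal (exp (- (a * pi * t))) \<partial>?M) =
      (\<integral>\<^sup>+ x. ennreal (exp (- (a * pi * (norm (x :: real ^ 2))\<^sup>2))) \<partial>density lborel (indicator (ball 0 \<eta>)))"
    by (rule nn_integral_distr) simp_all
  also have "\<dots> = (\<integral>\<^sup>+ x \<in> ball 0 \<eta>. ennreal (exp (- (a * pi * (norm (x :: real ^ 2))\<^sup>2))) \<partial>lborel)"
    by (subst nn_integral_density[OF borel_measurable_indicator]) (simp_all add: mult.commute)
  finally have "(\<integral>\<^sup>+ x \<in> ball 0 \<eta>. ennreal (exp (- (a * pi * (norm (x :: real ^ 2))\<^sup>2))) \<partial>lborel) =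
      (\<integral>\<^sup>+ t. ennreal (exp (- (a * pi * t))) \<partial>?M)" by simp
  also have "\<dots> = (\<integral>\<^sup>+ t. ennreal (pi * exp (- (a * pi * t))) * indicator {0..\<eta>\<^sup>2} t \<partial>lborel)"
    unfolding \<open>?M = ?N\<close> by (subst nn_integral_density) (auto intro!: nn_integral_cong simp: ennreal_mult mult_ac)
  also have "\<dots> = ennreal (- (exp (- (a * pi * \<eta>\<^sup>2)) / a) - (- (exp (- (a * pi * 0)) / a)))"
    by (rule nn_integral_FTC_Icc) (use assms in \<open>auto intro!: derivative_eq_intros\<close>)
  also have "\<dots> = ennreal ((1 - exp (- (a * pi * \<eta>\<^sup>2))) / a)"
    by (simp add: diff_divide_distrib)
  finally show ?thesis .
qed

section \<open>Factorization of expectations and averaging over the marks\<close>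

lemma (in prob_space) indep_var_nn_integral:
  fixes f g :: "'a \<Rightarrow> ennreal"
  assumes "indep_var borel f borel g"
  shows "(\<integral>\<^sup>+ \<omega>. f \<omega> * g \<omega> \<partial>M) = (\<integral>\<^sup>+ \<omega>. f \<omega> \<partial>M) * (\<integral>\<^sup>+ \<omega>. g \<omega> \<partial>M)"
proof -
  have "case_bool borel borel = (\<lambda>_. borel :: ennreal measure)"
    by (auto split: bool.split)
  then have "indep_vars (\<lambda>_. borel) (case_bool f g) UNIV"
    using assms by (simp add: indep_var_def)
  from indep_vars_nn_integral[OF _ this] show ?thesis
    by (simp add: UNIV_bool mult.commute)
qed

text \<open>The set of indices that must be unmarked is random, but where it matters it is finite
  and hence takes countably many values \<open>F\<close>. On each event
  \<open>J (Z \<omega>) = F\<close> the independence of the marks from \<open>Z\<close> gives the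
  factor \<open>(1 - p) ^ card F\<close>; summing over \<open>F\<close> replaces conditioning on
  \<open>Z\<close>.\<close>

lemma (in prob_space) emeasure_no_marks:
  fixes B :: "nat \<Rightarrow> 'a \<Rightarrow> bool" and Z :: "'a \<Rightarrow> 'z" and J :: "'z \<Rightarrow> nat set"
  assumes B: "indep_vars (\<lambda>_. count_space UNIV) B UNIV"
    and p: "\<And>n. prob {\<omega> \<in> space M. B n \<omega>} = p"
    and indep: "indep_elements M (\<Pi>\<^sub>M n\<in>UNIV. count_space UNIV) (\<lambda>\<omega> n. B n \<omega>) N Z"
    and D: "D \<in> sets N" and J: "\<And>m. {z \<in> space N. m \<in> J z} \<in> sets N"
    and fin: "\<And>\<omega>. \<omega> \<in> space M \<Longrightarrow> Z \<omega> \<in> D \<Longrightarrow> finite (J (Z \<omega>))"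
  shows "emeasure M {\<omega> \<in> space M. Z \<omega> \<in> D \<and> (\<forall>m\<in>J (Z \<omega>). \<not> B m \<omega>)} =
    (\<integral>\<^sup>+ \<omega>. indicator D (Z \<omega>) * ennreal ((1 - p) ^ card (J (Z \<omega>))) \<partial>M)"
proof -
  let ?I = "{F :: nat set. finite F}"
  define E V where "E F = {\<omega> \<in> space M. Z \<omega> \<in> D \<and> J (Z \<omega>) = F}"
    and "V F = {\<omega> \<in> space M. \<forall>m\<in>F. \<not> B m \<omega>}" for F
  have Bm [measurable]: "B n \<in> measurable M (count_space UNIV)" for n
    using B by (auto simp: indep_vars_def)
  have Zm [measurable]: "Z \<in> measurable M N"
    using indep by (simp add: indep_elements_def)
  have ind: "indep_set {(\<lambda>\<omega> n. B n \<omega>) -` A \<inter> space M | A. A \<in> sets (\<Pi>\<^sub>M n\<in>UNIV. count_space UNIV)}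
      {Z -` A \<inter> space M | A. A \<in> sets N}"
    using indep by (simp add: indep_elements_def)
  \<comment> \<open>Equality of two sets of naturals is a countable conjunction of membership
    statements, so measurability of each \<open>m \<in> J z\<close> is enough.\<close>
  have DF: "{z \<in> space N. z \<in> D \<and> J z = F} \<in> sets N" for F
  proof -
    have [measurable]: "Measurable.pred N (\<lambda>z. m \<in> J z)" for m
      using J[of m] by (simp add: pred_def)
    have [measurable]: "Measurable.pred N (\<lambda>z. z \<in> D)" using D by simp
    have "{z \<in> space N. z \<in> D \<and> (\<forall>m. m \<in> J z \<longleftrightarrow> m \<in> F)} \<in> sets N" by measurable
    then show ?thesis by (simp add: set_eq_iff)
  qed
  have E_eq: "E F = Z -` {z \<in> space N. z \<in> D \<and> J z = F} \<inter> space M" for F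
    using measurable_space[OF Zm] by (auto simp: E_def)
  have E [measurable]: "E F \<in> events" for F
    unfolding E_eq by (rule measurable_sets[OF Zm DF])
  have V [measurable]: "V F \<in> events" if "finite F" for F
    using that unfolding V_def by (auto intro: countable_finite)
  have probV: "prob (V F) = (1 - p) ^ card F" if "finite F" for F
  proof (cases "F = {}")
    case False
    have "V F = (\<Inter>n\<in>F. B n -` {False} \<inter> space M)"
      using False by (auto simp: V_def)
    also have "prob \<dots> = (\<Prod>n\<in>F. prob (B n -` {False} \<inter> space M))"
      using that False by (intro indep_varsD[OF B]) auto
    also have "\<dots> = (\<Prod>n\<in>F. 1 - p)"
    proof (rule prod.cong)
      fix n
      have "B n -` {False} \<inter> space M = space M - {\<omega> \<in> space M. B n \<omega>}" by auto
      then show "prob (B n -` {False} \<inter> space M) = 1 - p"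
        using prob_compl[of "{\<omega> \<in> space M. B n \<omega>}"] p[of n] by simp
    qed simp
    finally show ?thesis by simp
  qed (simp add: V_def prob_space)
  have p1: "0 \<le> 1 - p" using p[of 0] prob_le_1[of "{\<omega> \<in> space M. B 0 \<omega>}"] by simp
  have EV: "emeasure M (E F \<inter> V F) = emeasure M (E F) * ennreal ((1 - p) ^ card F)"
    if "finite F" for F
  proof -
    \<comment> \<open>Independence is given for the whole sequence of marks, so silence on
      \<open>F\<close> is expressed as an event of the product space.\<close>
    let ?A = "{b \<in> space (\<Pi>\<^sub>M n\<in>UNIV. count_space UNIV). \<forall>m\<in>F. \<not> b m}"
    have "?A \<in> sets (\<Pi>\<^sub>M n\<in>UNIV. count_space UNIV)"
    proof (rule sets.sets_Collect_finite_All)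
      show "{b \<in> space (\<Pi>\<^sub>M n\<in>UNIV. count_space UNIV). \<not> b m} \<in> sets (\<Pi>\<^sub>M n\<in>UNIV. count_space UNIV)"
        for m :: nat by measurable
    qed (use that in auto)
    moreover have "V F = (\<lambda>\<omega> n. B n \<omega>) -` ?A \<inter> space M"
      by (auto simp: V_def space_PiM)
    ultimately have "prob (V F \<inter> E F) = prob (V F) * prob (E F)"
      using DF unfolding E_eq by (intro indep_setD[OF ind]) blast+
    then show ?thesis
      using p1 by (simp add: emeasure_eq_measure probV[OF that] Int_commute mult.commute ennreal_mult)
  qed
  have "{\<omega> \<in> space M. Z \<omega> \<in> D \<and> (\<forall>m\<in>J (Z \<omega>). \<not> B m \<omega>)} = (\<Union>F\<in>?I. E F \<inter> V F)"
    using fin by (auto simp: E_def V_def)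
  also have "emeasure M \<dots> = (\<integral>\<^sup>+ F. emeasure M (E F \<inter> V F) \<partial>count_space ?I)"
    by (rule emeasure_UN_countable)
       (auto intro!: countable_Collect_finite sets.Int simp: disjoint_family_on_def, auto simp: E_def)
  also have "\<dots> = (\<integral>\<^sup>+ F. (\<integral>\<^sup>+ \<omega>. indicator (E F) \<omega> * ennreal ((1 - p) ^ card F) \<partial>M) \<partial>count_space ?I)"
    by (intro nn_integral_cong) (auto simp: EV nn_integral_multc)
  also have "\<dots> = (\<integral>\<^sup>+ \<omega>. (\<integral>\<^sup>+ F. indicator (E F) \<omega> * ennreal ((1 - p) ^ card F) \<partial>count_space ?I) \<partial>M)"
    by (rule nn_integral_count_space_nn_integral[symmetric]) (auto intro!: countable_Collect_finite)
  also have "\<dots> = (\<integral>\<^sup>+ \<omega>. indicator D (Z \<omega>) * ennreal ((1 - p) ^ card (J (Z \<omega>))) \<partial>M)"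
  proof (rule nn_integral_cong)
    fix \<omega> assume \<omega>: "\<omega> \<in> space M"
    \<comment> \<open>Only the term \<open>F = ?F\<close> survives in the sum. Outside
      \<open>D\<close>, where \<open>?F\<close> may be infinite and so not among the indices, both
      sides vanish.\<close>
    let ?F = "J (Z \<omega>)"
    have "(\<integral>\<^sup>+ F. indicator (E F) \<omega> * ennreal ((1 - p) ^ card F) \<partial>count_space ?I) =
        (\<integral>\<^sup>+ F. indicator D (Z \<omega>) * ennreal ((1 - p) ^ card ?F) * indicator {?F} F \<partial>count_space ?I)"
      using \<omega> by (intro nn_integral_cong) (auto simp: E_def indicator_def)
    also have "\<dots> = indicator D (Z \<omega>) * ennreal ((1 - p) ^ card ?F)"
      using fin[OF \<omega>] by (cases "Z \<omega> \<in> D") (auto simp: nn_integral_cmult_indicator)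
    finally show "(\<integral>\<^sup>+ F. indicator (E F) \<omega> * ennreal ((1 - p) ^ card F) \<partial>count_space ?I) =
      indicator D (Z \<omega>) * ennreal ((1 - p) ^ card ?F)" .
  qed
  finally show ?thesis .
qed

text \<open>The void probability of \<open>\<Psi>\<close> on \<open>E\<close> is encoded as the expectation of \<open>0 ^ card (\<Psi> \<omega> \<inter> E)\<close>.\<close>
lemma (in prob_space) nn_integral_poisson_pair:
  fixes \<Phi> \<Psi> :: "'a \<Rightarrow> 'b::euclidean_space set" and r q l e :: real
  assumes \<Phi>: "poisson_point_process M l \<Phi>" and \<Psi>: "poisson_point_process M e \<Psi>"
    and indep: "indep_var config_space \<Phi> config_space \<Psi>"
    and nonneg: "0 \<le> l" "0 \<le> e" "0 \<le> r" "0 \<le> q"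
    and Q: "Q \<in> sets borel" "bounded Q" and A: "A \<in> sets borel" "bounded A"
    and E: "E \<in> sets borel" "bounded E" and disj: "Q \<inter> A = {}"
  shows "(\<integral>\<^sup>+ \<omega>. ennreal (card (\<Phi> \<omega> \<inter> Q) * r ^ card (\<Phi> \<omega> \<inter> Q) * q ^ card (\<Phi> \<omega> \<inter> A) *
        0 ^ card (\<Psi> \<omega> \<inter> E)) \<partial>M) =
    ennreal (r * (l * measure lborel Q) * exp (- ((1 - r) * (l * measure lborel Q))) *
      exp (- ((1 - q) * (l * measure lborel A))) * exp (- (e * measure lborel E)))"
proof -
  have [measurable]: "\<Phi> \<in> measurable M config_space" "\<Psi> \<in> measurable M config_space"
    using \<Phi> \<Psi> by (simp_all add: poisson_point_process_def)
  note [measurable] = measurable_card_Int_config_space[OF Q]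
    measurable_card_Int_config_space[OF A] measurable_card_Int_config_space[OF E]
  define f where "f = (\<lambda>S. ennreal (card (S \<inter> Q) * r ^ card (S \<inter> Q)) * ennreal (q ^ card (S \<inter> A)))"
  define g where "g = (\<lambda>T :: 'b set. ennreal (0 ^ card (T \<inter> E)))"
  have [measurable]: "f \<in> borel_measurable config_space" "g \<in> borel_measurable config_space"
    unfolding f_def g_def by measurable
  have fg: "(\<integral>\<^sup>+ \<omega>. f (\<Phi> \<omega>) * g (\<Psi> \<omega>) \<partial>M) = (\<integral>\<^sup>+ \<omega>. f (\<Phi> \<omega>) \<partial>M) * (\<integral>\<^sup>+ \<omega>. g (\<Psi> \<omega>) \<partial>M)"
    using indep_var_compose[OF indep, of f borel g borel]
    by (intro indep_var_nn_integral) (simp_all add: comp_def)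
  have prob_card: "prob {\<omega> \<in> space M. card (\<Phi> \<omega> \<inter> B) = k} =
      (l * measure lborel B) ^ k / fact k * exp (- (l * measure lborel B))"
    if "B \<in> sets borel" "bounded B" for B k
    using \<Phi> that by (simp add: poisson_point_process_def)
  have "(\<integral>\<^sup>+ \<omega>. f (\<Phi> \<omega>) \<partial>M) =
      (\<integral>\<^sup>+ \<omega>. ennreal (card (\<Phi> \<omega> \<inter> Q) * r ^ card (\<Phi> \<omega> \<inter> Q)) \<partial>M) * (\<integral>\<^sup>+ \<omega>. ennreal (q ^ card (\<Phi> \<omega> \<inter> A)) \<partial>M)"
  proof -
    \<comment> \<open>Independence of counts is stated for families over an initial segment of the
      naturals; the pair of regions becomes a family over \<open>{..<2}\<close>.\<close>
    define B where "B i = (if i = (0::nat) then Q else A)" for i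
    define Y where "Y i k = (if i = (0::nat) then ennreal (real k * r ^ k) else ennreal (q ^ k))" for i k
    have "\<forall>i<2. B i \<in> sets borel \<and> bounded (B i)" using Q A by (simp add: B_def)
    moreover have "disjoint_family_on B {..<2::nat}"
      using disj by (auto simp: disjoint_family_on_def B_def)
    ultimately have "indep_vars (\<lambda>_. count_space UNIV) (\<lambda>i \<omega>. card (\<Phi> \<omega> \<inter> B i)) {..<2::nat}"
      using \<Phi> unfolding poisson_point_process_def by blast
    then have "indep_vars (\<lambda>_. borel) (\<lambda>i \<omega>. Y i (card (\<Phi> \<omega> \<inter> B i))) {..<2::nat}"
      by (rule indep_vars_compose2) simp
    from indep_vars_nn_integral[OF _ this]
    have "(\<integral>\<^sup>+ \<omega>. (\<Prod>i<2. Y i (card (\<Phi> \<omega> \<inter> B i))) \<partial>M) = (\<Prod>i<2. \<integral>\<^sup>+ \<omega>. Y i (card (\<Phi> \<omega> \<inter> B i)) \<partial>M)"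
      by simp
    then show ?thesis
      by (simp add: numeral_2_eq_2 Y_def B_def f_def)
  qed
  also have "\<dots> = ennreal (r * (l * measure lborel Q) * exp (- ((1 - r) * (l * measure lborel Q)))) *
      ennreal (exp (- ((1 - q) * (l * measure lborel A))))"
    using nonneg Q A
    by (intro arg_cong2[where f = "(*)"] nn_integral_times_power_poisson nn_integral_power_poisson)
       (simp_all add: prob_card measure_nonneg)
  finally have 1: "(\<integral>\<^sup>+ \<omega>. f (\<Phi> \<omega>) \<partial>M) = \<dots>" .
  have 2: "(\<integral>\<^sup>+ \<omega>. g (\<Psi> \<omega>) \<partial>M) = ennreal (exp (- (e * measure lborel E)))"
    using nn_integral_power_poisson[of "\<lambda>\<omega>. card (\<Psi> \<omega> \<inter> E)" "e * measure lborel E" 0] \<Psi> nonneg E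
    by (simp add: g_def poisson_point_process_def measure_nonneg)
  have "(\<integral>\<^sup>+ \<omega>. ennreal (card (\<Phi> \<omega> \<inter> Q) * r ^ card (\<Phi> \<omega> \<inter> Q) * q ^ card (\<Phi> \<omega> \<inter> A) *
        0 ^ card (\<Psi> \<omega> \<inter> E)) \<partial>M) = (\<integral>\<^sup>+ \<omega>. f (\<Phi> \<omega>) * g (\<Psi> \<omega>) \<partial>M)"
    using nonneg unfolding f_def g_def by (intro nn_integral_cong) (simp add: ennreal_mult)
  then show ?thesis
    unfolding fg 1 2 using nonneg by (simp add: ennreal_mult)
qed

section \<open>Stability of the exponent under a shift of size \<epsilon>\<close>

text \<open>Here \<open>r\<close> and \<open>t\<close> are the norms of the centre and of a point of a cell of radius \<open>\<epsilon>\<close>; \<open>A\<close> and \<open>E\<close>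
  are the areas of regions approximating the disks of radius \<open>\<beta> * t\<close> and \<open>\<gamma> * t\<close>.\<close>
lemma exponent_upper:
  fixes a b k R \<epsilon> \<beta> \<gamma> r t A E :: real
  assumes "0 \<le> a" "0 \<le> b" "0 < \<beta>" "0 < \<gamma>" "0 < \<epsilon>" "\<epsilon> \<le> 1" "0 \<le> r" "r \<le> R" "0 \<le> t" "\<bar>t - r\<bar> \<le> \<epsilon>"
    and A: "A \<ge> pi * (max 0 (\<beta> * r - (1 + \<beta>) * \<epsilon>))\<^sup>2 - pi * \<epsilon>\<^sup>2"
    and E: "E \<ge> pi * (\<gamma> * max 0 (r - \<epsilon>))\<^sup>2"
    and k: "k = a * \<beta>\<^sup>2 + b * \<gamma>\<^sup>2"
  shows "k * pi * t\<^sup>2 - pi * (a * (2 * \<beta> * R * (1 + \<beta>) + (1 + \<beta>)\<^sup>2 + 1) + b * \<gamma>\<^sup>2 * (2 * R + 1) + k * (2 * R + 3)) * \<epsilon>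
    \<le> a * A + b * E"
proof -
  have R: "0 \<le> R" using assms by simp
  \<comment> \<open>The inner radius is truncated at 0. The linear lower bound for the square
    survives the truncation, since for \<open>u < v\<close> its right-hand side is at most
    \<open>- u * v\<close>.\<close>
  have max_sq: "(max 0 (u - v))\<^sup>2 \<ge> u\<^sup>2 - 2 * u * v" if "0 \<le> u" "0 \<le> v" for u v :: real
  proof (cases "v \<le> u")
    case True
    then show ?thesis by (simp add: power2_diff)
  next
    case False
    then have "u * u \<le> u * v" using that by (intro mult_left_mono) auto
    moreover have "0 \<le> u * v" using that by simp
    ultimately show ?thesis using False by (simp add: power2_eq_square)
  qed
  have e2: "\<epsilon>\<^sup>2 \<le> \<epsilon>" using assms by (simp add: power2_eq_square mult_left_le)
  have "A \<ge> pi * (\<beta>\<^sup>2 * r\<^sup>2 - (2 * \<beta> * R * (1 + \<beta>) + (1 + \<beta>)\<^sup>2 + 1) * \<epsilon>)"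
  proof -
    have "2 * (\<beta> * r) * ((1 + \<beta>) * \<epsilon>) \<le> 2 * (\<beta> * R) * ((1 + \<beta>) * \<epsilon>)"
      using assms by (intro mult_right_mono mult_left_mono) auto
    moreover have "0 \<le> (1 + \<beta>)\<^sup>2 * \<epsilon>" using assms by simp
    moreover have "(2 * \<beta> * R * (1 + \<beta>) + (1 + \<beta>)\<^sup>2 + 1) * \<epsilon> =
        2 * (\<beta> * R) * ((1 + \<beta>) * \<epsilon>) + (1 + \<beta>)\<^sup>2 * \<epsilon> + \<epsilon>"
      by (simp add: algebra_simps)
    moreover have "(max 0 (\<beta> * r - (1 + \<beta>) * \<epsilon>))\<^sup>2 \<ge> (\<beta> * r)\<^sup>2 - 2 * (\<beta> * r) * ((1 + \<beta>) * \<epsilon>)"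
      using assms by (intro max_sq) auto
    moreover have "(\<beta> * r)\<^sup>2 = \<beta>\<^sup>2 * r\<^sup>2" by (simp add: power_mult_distrib)
    ultimately have "\<beta>\<^sup>2 * r\<^sup>2 - (2 * \<beta> * R * (1 + \<beta>) + (1 + \<beta>)\<^sup>2 + 1) * \<epsilon>
        \<le> (max 0 (\<beta> * r - (1 + \<beta>) * \<epsilon>))\<^sup>2 - \<epsilon>\<^sup>2"
      using e2 by linarith
    from mult_left_mono[OF this, of pi] show ?thesis using A by (simp add: right_diff_distrib)
  qed
  from mult_left_mono[OF this \<open>0 \<le> a\<close>]
  have 1: "a * (pi * (\<beta>\<^sup>2 * r\<^sup>2 - (2 * \<beta> * R * (1 + \<beta>) + (1 + \<beta>)\<^sup>2 + 1) * \<epsilon>)) \<le> a * A" .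
  have "E \<ge> pi * (\<gamma>\<^sup>2 * (r\<^sup>2 - (2 * R + 1) * \<epsilon>))"
  proof -
    have "2 * r * \<epsilon> \<le> 2 * R * \<epsilon>"
      using assms by (intro mult_right_mono) auto
    moreover have "(2 * R + 1) * \<epsilon> = 2 * R * \<epsilon> + \<epsilon>" by (simp add: algebra_simps)
    ultimately have "r\<^sup>2 - (2 * R + 1) * \<epsilon> \<le> (max 0 (r - \<epsilon>))\<^sup>2"
      using max_sq[of r \<epsilon>] assms by linarith
    then have "pi * \<gamma>\<^sup>2 * (r\<^sup>2 - (2 * R + 1) * \<epsilon>) \<le> pi * \<gamma>\<^sup>2 * (max 0 (r - \<epsilon>))\<^sup>2"
      by (intro mult_left_mono) auto
    with E show ?thesis by (simp only: power_mult_distrib mult.assoc)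
  qed
  from mult_left_mono[OF this \<open>0 \<le> b\<close>]
  have 2: "b * (pi * (\<gamma>\<^sup>2 * (r\<^sup>2 - (2 * R + 1) * \<epsilon>))) \<le> b * E" .
  have "t\<^sup>2 \<le> (r + \<epsilon>)\<^sup>2" using assms by (intro power_mono) auto
  moreover have "2 * r * \<epsilon> \<le> 2 * R * \<epsilon>"
    using assms by (intro mult_right_mono) auto
  moreover have "(r + \<epsilon>)\<^sup>2 = r\<^sup>2 + 2 * r * \<epsilon> + \<epsilon>\<^sup>2" by (simp add: power2_sum)
  moreover have "(2 * R + 3) * \<epsilon> = 2 * R * \<epsilon> + 3 * \<epsilon>" by (simp add: algebra_simps)
  ultimately have "t\<^sup>2 \<le> r\<^sup>2 + (2 * R + 3) * \<epsilon>"
    using e2 assms by linarith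
  moreover have "0 \<le> k * pi" using assms by simp
  ultimately have 3: "k * pi * t\<^sup>2 \<le> k * pi * (r\<^sup>2 + (2 * R + 3) * \<epsilon>)"
    by (rule mult_left_mono)
  from 1 2 3 show ?thesis unfolding k by (simp add: algebra_simps)
qed

text \<open>The error constant is that of \<open>exponent_upper\<close>, so a single
  \<open>C\<close> serves both directions. Expanding the squares and using \<epsilon>^2 \<le>
  \<epsilon> explains it: \<open>2 * \<beta> * R * (1 + \<beta>)\<close> and
  \<open>(1 + \<beta>)\<^sup>2\<close> come from the enlarged disk of interferers, the following
  \<open>1\<close> from the area of the cell, \<open>2 * R + 1\<close> from the disk of
  eavesdroppers, and \<open>2 * R + 3\<close> from replacing \<open>r\<close> by \<open>t\<close>,
  where \<open>t \<le> R + 1\<close>.\<close>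

lemma exponent_lower:
  fixes a b k R \<epsilon> \<beta> \<gamma> r t A E :: real
  assumes "0 \<le> a" "0 \<le> b" "0 < \<beta>" "0 < \<gamma>" "0 < \<epsilon>" "\<epsilon> \<le> 1" "0 \<le> r" "r \<le> R" "0 \<le> t" "\<bar>t - r\<bar> \<le> \<epsilon>"
    and A: "A \<le> pi * (\<beta> * r + (1 + \<beta>) * \<epsilon>)\<^sup>2 + pi * \<epsilon>\<^sup>2"
    and E: "E \<le> pi * (\<gamma> * (r + \<epsilon>))\<^sup>2"
    and k: "k = a * \<beta>\<^sup>2 + b * \<gamma>\<^sup>2"
  shows "a * A + b * E \<le>
    k * pi * t\<^sup>2 + pi * (a * (2 * \<beta> * R * (1 + \<beta>) + (1 + \<beta>)\<^sup>2 + 1) + b * \<gamma>\<^sup>2 * (2 * R + 1) + k * (2 * R + 3)) * \<epsilon>"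
proof -
  have R: "0 \<le> R" using assms by simp
  have e2: "\<epsilon>\<^sup>2 \<le> \<epsilon>" using assms by (simp add: power2_eq_square mult_left_le)
  have "A \<le> pi * (\<beta>\<^sup>2 * r\<^sup>2 + (2 * \<beta> * R * (1 + \<beta>) + (1 + \<beta>)\<^sup>2 + 1) * \<epsilon>)"
  proof -
    have "2 * (\<beta> * r) * ((1 + \<beta>) * \<epsilon>) \<le> 2 * (\<beta> * R) * ((1 + \<beta>) * \<epsilon>)"
      using assms by (intro mult_right_mono mult_left_mono) auto
    moreover have "(1 + \<beta>)\<^sup>2 * \<epsilon>\<^sup>2 \<le> (1 + \<beta>)\<^sup>2 * \<epsilon>" using e2 by (intro mult_left_mono) auto
    moreover have "(\<beta> * r + (1 + \<beta>) * \<epsilon>)\<^sup>2 = \<beta>\<^sup>2 * r\<^sup>2 + 2 * (\<beta> * r) * ((1 + \<beta>) * \<epsilon>) + (1 + \<beta>)\<^sup>2 * \<epsilon>\<^sup>2"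
      by (simp add: power2_sum power_mult_distrib)
    moreover have "(2 * \<beta> * R * (1 + \<beta>) + (1 + \<beta>)\<^sup>2 + 1) * \<epsilon> =
        2 * (\<beta> * R) * ((1 + \<beta>) * \<epsilon>) + (1 + \<beta>)\<^sup>2 * \<epsilon> + \<epsilon>"
      by (simp add: algebra_simps)
    ultimately have "(\<beta> * r + (1 + \<beta>) * \<epsilon>)\<^sup>2 + \<epsilon>\<^sup>2
        \<le> \<beta>\<^sup>2 * r\<^sup>2 + (2 * \<beta> * R * (1 + \<beta>) + (1 + \<beta>)\<^sup>2 + 1) * \<epsilon>"
      using e2 by linarith
    from mult_left_mono[OF this, of pi] show ?thesis using A by (simp add: distrib_left)
  qed
  from mult_left_mono[OF this \<open>0 \<le> a\<close>]
  have 1: "a * A \<le> a * (pi * (\<beta>\<^sup>2 * r\<^sup>2 + (2 * \<beta> * R * (1 + \<beta>) + (1 + \<beta>)\<^sup>2 + 1) * \<epsilon>))" .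
  have "E \<le> pi * (\<gamma>\<^sup>2 * (r\<^sup>2 + (2 * R + 1) * \<epsilon>))"
  proof -
    have "2 * r * \<epsilon> \<le> 2 * R * \<epsilon>"
      using assms by (intro mult_right_mono) auto
    then have "(r + \<epsilon>)\<^sup>2 \<le> r\<^sup>2 + (2 * R + 1) * \<epsilon>"
      using e2 by (simp add: power2_sum algebra_simps)
    then have "pi * \<gamma>\<^sup>2 * (r + \<epsilon>)\<^sup>2 \<le> pi * \<gamma>\<^sup>2 * (r\<^sup>2 + (2 * R + 1) * \<epsilon>)"
      by (intro mult_left_mono) auto
    with E show ?thesis by (simp only: power_mult_distrib mult.assoc)
  qed
  from mult_left_mono[OF this \<open>0 \<le> b\<close>]
  have 2: "b * E \<le> b * (pi * (\<gamma>\<^sup>2 * (r\<^sup>2 + (2 * R + 1) * \<epsilon>)))" .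
  have "r\<^sup>2 \<le> (t + \<epsilon>)\<^sup>2" using assms by (intro power_mono) auto
  moreover have "2 * t * \<epsilon> \<le> 2 * (R + 1) * \<epsilon>"
    using assms by (intro mult_right_mono) auto
  moreover have "(t + \<epsilon>)\<^sup>2 = t\<^sup>2 + 2 * t * \<epsilon> + \<epsilon>\<^sup>2" by (simp add: power2_sum)
  moreover have "(2 * R + 3) * \<epsilon> = 2 * (R + 1) * \<epsilon> + \<epsilon>" by (simp add: algebra_simps)
  ultimately have "r\<^sup>2 \<le> t\<^sup>2 + (2 * R + 3) * \<epsilon>"
    using e2 by linarith
  moreover have "0 \<le> k * pi" using assms by simp
  ultimately have 3: "k * pi * r\<^sup>2 \<le> k * pi * (t\<^sup>2 + (2 * R + 3) * \<epsilon>)"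
    by (rule mult_left_mono)
  from 1 2 3 show ?thesis unfolding k by (simp add: algebra_simps)
qed

section \<open>Two-sided bounds for the expected weight of one cell\<close>

lemma measure_ball_plane: "0 \<le> r \<Longrightarrow> measure lborel (ball (c :: real ^ 2) r) = pi * r\<^sup>2"
  by (simp add: content_ball unit_ball_vol_2)

lemma fmeasurable_lborel_bounded:
  "A \<in> sets borel \<Longrightarrow> bounded A \<Longrightarrow> A \<in> fmeasurable lborel"
  using emeasure_bounded_finite[of A] by (auto intro!: fmeasurableI)

lemma finite_Int_poisson:
  assumes "poisson_point_process M l \<Phi>" "\<omega> \<in> space M" "bounded A"
  shows "finite (\<Phi> \<omega> \<inter> A)"
  using assms measurable_space[of \<Phi> M config_space \<omega>]
  by (auto simp: poisson_point_process_def space_config_space locally_finite_set_def)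

text \<open>The origin is the transmitter and hence never interferes; the point \<open>x\<close> is counted because it
  must not transmit itself.\<close>
definition link_weight ::
    "real \<Rightarrow> real \<Rightarrow> real \<Rightarrow> (real ^ 2) set \<Rightarrow> (real ^ 2) set \<Rightarrow> real ^ 2 \<Rightarrow> real" where
  "link_weight \<beta> \<gamma> q S T x =
     q ^ card (S \<inter> insert x (ball x (\<beta> * norm x) - {0})) * of_bool (T \<inter> ball 0 (\<gamma> * norm x) = {})"

locale poisson_pair = prob_space M for M :: "'w measure" +
  fixes \<Phi> \<Psi> :: "'w \<Rightarrow> (real ^ 2) set" and l e :: real
  assumes \<Phi>: "poisson_point_process M l \<Phi>" and \<Psi>: "poisson_point_process M e \<Psi>"
    and indep: "indep_var config_space \<Phi> config_space \<Psi>"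
    and nonneg: "0 \<le> l" "0 \<le> e"
begin

context
  fixes q \<beta> \<gamma> \<epsilon> R k C :: real and Q :: "(real ^ 2) set" and c :: "real ^ 2"
  assumes q: "0 \<le> q" "q \<le> 1" and pos: "0 < \<beta>" "0 < \<gamma>" and \<epsilon>: "0 < \<epsilon>" "\<epsilon> \<le> 1"
    and Q: "Q \<in> sets borel" "Q \<subseteq> ball c \<epsilon>" and R: "norm c \<le> R"
    and k: "k = (1 - q) * l * \<beta>\<^sup>2 + e * \<gamma>\<^sup>2"
    and C: "C = pi * ((1 - q) * l * (2 * \<beta> * R * (1 + \<beta>) + (1 + \<beta>)\<^sup>2 + 1) + e * \<gamma>\<^sup>2 * (2 * R + 1) + k * (2 * R + 3))"
begin

lemma bounded_cell: "bounded Q"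
  using Q bounded_subset bounded_ball by blast

lemma measure_cell_le: "measure lborel Q \<le> pi * \<epsilon>\<^sup>2"
proof -
  have "measure lborel Q \<le> measure lborel (ball c \<epsilon>)"
    using Q by (intro measure_mono_fmeasurable fmeasurable_lborel_bounded) auto
  then show ?thesis using \<epsilon> by (simp add: measure_ball_plane)
qed

lemma norm_cell: "x \<in> Q \<Longrightarrow> \<bar>norm x - norm c\<bar> < \<epsilon>"
  using Q norm_triangle_ineq3[of x c] by (force simp: dist_norm norm_minus_commute)

text \<open>A point of the cell accounts for one factor \<open>q\<close>, so that the rest of the cell can be cut
  out of the disk; disjointness of the two regions then makes the counts independent.\<close>
lemma cell_upper_bound:
  "(\<integral>\<^sup>+ \<omega>. (\<Sum>x\<in>\<Phi> \<omega> \<inter> Q. ennreal (link_weight \<beta> \<gamma> q (\<Phi> \<omega>) (\<Psi> \<omega>) x)) \<partial>M) \<le>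
    ennreal (l * q * exp (C * \<epsilon>)) * (\<integral>\<^sup>+ x\<in>Q. ennreal (exp (- (k * pi * (norm x)\<^sup>2))) \<partial>lborel)"
proof -
  \<comment> \<open>\<open>ball c s\<close> lies in the disk of every receiver \<open>x\<close> of
    the cell: moving the centre costs at most \<epsilon>, and the radius shrinks by at most
    \<open>\<beta> * \<epsilon>\<close>. The truncation keeps the radius nonnegative for the area
    formula. The origin is removed because a point there is the transmitter and does not
    interfere.\<close>
  define s where "s = max 0 (\<beta> * norm c - (1 + \<beta>) * \<epsilon>)"
  define A where "A = ball c s - insert 0 Q"
  define E where "E = ball (0 :: real ^ 2) (\<gamma> * max 0 (norm c - \<epsilon>))"
  have meas: "A \<in> sets borel" "bounded A" "E \<in> sets borel" "bounded E"
    using Q by (auto simp: A_def E_def intro: bounded_subset[OF bounded_ball[of c s]])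
  have weight: "link_weight \<beta> \<gamma> q (\<Phi> \<omega>) (\<Psi> \<omega>) x \<le>
      q * (q ^ card (\<Phi> \<omega> \<inter> A) * 0 ^ card (\<Psi> \<omega> \<inter> E))"
    if \<omega>: "\<omega> \<in> space M" and x: "x \<in> \<Phi> \<omega> \<inter> Q" for \<omega> x
  proof -
    let ?S = "\<Phi> \<omega> \<inter> insert x (ball x (\<beta> * norm x) - {0})"
    have "A \<subseteq> ball x (\<beta> * norm x) - {0}"
    proof
      fix y assume y: "y \<in> A"
      then have "dist c y < s" by (simp add: A_def)
      then have "dist c y < \<beta> * norm c - (1 + \<beta>) * \<epsilon>"
        using zero_le_dist[of c y] unfolding s_def by linarith
      moreover have "dist c x < \<epsilon>" using x Q by auto
      moreover have "dist x y \<le> dist c x + dist c y" by (rule dist_triangle3)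
      moreover have "\<beta> * (norm c - \<epsilon>) \<le> \<beta> * norm x"
        using norm_cell[of x] x pos by (intro mult_left_mono) auto
      ultimately show "y \<in> ball x (\<beta> * norm x) - {0}"
        using y by (auto simp: algebra_simps A_def)
    qed
    moreover have "x \<notin> A" using x by (simp add: A_def)
    moreover have fin: "finite ?S" by (rule finite_Int_poisson[OF \<Phi> \<omega>]) auto
    \<comment> \<open>The receiver is outside \<open>A\<close> but is counted in the weight; this is
      the extra factor \<open>q\<close>.\<close>
    ultimately have "card (insert x (\<Phi> \<omega> \<inter> A)) \<le> card ?S"
      using x by (intro card_mono) auto
    then have "q ^ card ?S \<le> q ^ Suc (card (\<Phi> \<omega> \<inter> A))"
      using finite_Int_poisson[OF \<Phi> \<omega> meas(2)] \<open>x \<notin> A\<close> q by (intro power_decreasing) auto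
    moreover have "of_bool (\<Psi> \<omega> \<inter> ball 0 (\<gamma> * norm x) = {}) \<le> (0 :: real) ^ card (\<Psi> \<omega> \<inter> E)"
    proof -
      have "E \<subseteq> ball 0 (\<gamma> * norm x)"
        unfolding E_def using norm_cell[of x] x pos by (intro subset_ball mult_left_mono) auto
      then have "\<Psi> \<omega> \<inter> E = {}" if "\<Psi> \<omega> \<inter> ball 0 (\<gamma> * norm x) = {}"
        using that by blast
      then show ?thesis by auto
    qed
    ultimately have "link_weight \<beta> \<gamma> q (\<Phi> \<omega>) (\<Psi> \<omega>) x \<le>
        q ^ Suc (card (\<Phi> \<omega> \<inter> A)) * 0 ^ card (\<Psi> \<omega> \<inter> E)"
      unfolding link_weight_def using q by (intro mult_mono) auto
    then show ?thesis by (simp add: mult.assoc)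
  qed
  \<comment> \<open>The bound is the same for each point of the cell, so the sum becomes a multiple
    of the count. The factor \<open>1 ^ card\<close> brings it to the form of
    \<open>nn_integral_poisson_pair\<close> with \<open>r = 1\<close>.\<close>
  have "(\<integral>\<^sup>+ \<omega>. (\<Sum>x\<in>\<Phi> \<omega> \<inter> Q. ennreal (link_weight \<beta> \<gamma> q (\<Phi> \<omega>) (\<Psi> \<omega>) x)) \<partial>M) \<le>
      (\<integral>\<^sup>+ \<omega>. ennreal q * ennreal (card (\<Phi> \<omega> \<inter> Q) * (1::real) ^ card (\<Phi> \<omega> \<inter> Q) * q ^ card (\<Phi> \<omega> \<inter> A) *
        0 ^ card (\<Psi> \<omega> \<inter> E)) \<partial>M)"
  proof (rule nn_integral_mono)
    fix \<omega> assume \<omega>: "\<omega> \<in> space M"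
    have "(\<Sum>x\<in>\<Phi> \<omega> \<inter> Q. ennreal (link_weight \<beta> \<gamma> q (\<Phi> \<omega>) (\<Psi> \<omega>) x)) \<le>
        (\<Sum>x\<in>\<Phi> \<omega> \<inter> Q. ennreal (q * (q ^ card (\<Phi> \<omega> \<inter> A) * 0 ^ card (\<Psi> \<omega> \<inter> E))))"
      using weight[OF \<omega>] by (intro sum_mono ennreal_leI) auto
    also have "\<dots> = ennreal q * ennreal (card (\<Phi> \<omega> \<inter> Q) * (1::real) ^ card (\<Phi> \<omega> \<inter> Q) *
        q ^ card (\<Phi> \<omega> \<inter> A) * 0 ^ card (\<Psi> \<omega> \<inter> E))"
      using q by (simp add: ennreal_mult ennreal_of_nat_eq_real_of_nat mult_ac)
    finally show "(\<Sum>x\<in>\<Phi> \<omega> \<inter> Q. ennreal (link_weight \<beta> \<gamma> q (\<Phi> \<omega>) (\<Psi> \<omega>) x)) \<le> \<dots>" .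
  qed
  also have "\<dots> = ennreal q * (\<integral>\<^sup>+ \<omega>. ennreal (card (\<Phi> \<omega> \<inter> Q) * (1::real) ^ card (\<Phi> \<omega> \<inter> Q) *
        q ^ card (\<Phi> \<omega> \<inter> A) * 0 ^ card (\<Psi> \<omega> \<inter> E)) \<partial>M)"
  proof (rule nn_integral_cmult)
    have [measurable]: "\<Phi> \<in> measurable M config_space" "\<Psi> \<in> measurable M config_space"
      using \<Phi> \<Psi> by (simp_all add: poisson_point_process_def)
    note [measurable] = measurable_card_Int_config_space[OF Q(1) bounded_cell]
      measurable_card_Int_config_space[OF meas(1,2)] measurable_card_Int_config_space[OF meas(3,4)]
    show "(\<lambda>\<omega>. ennreal (card (\<Phi> \<omega> \<inter> Q) * (1::real) ^ card (\<Phi> \<omega> \<inter> Q) * q ^ card (\<Phi> \<omega> \<inter> A) *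
        0 ^ card (\<Psi> \<omega> \<inter> E))) \<in> borel_measurable M" by measurable
  qed
  also have "\<dots> = ennreal (l * q * exp (- ((1 - q) * l * measure lborel A + e * measure lborel E)) * measure lborel Q)"
    using nonneg q Q meas bounded_cell
    by (subst nn_integral_poisson_pair[OF \<Phi> \<Psi> indep])
       (auto simp: A_def ennreal_mult[symmetric] exp_add[symmetric] exp_minus measure_nonneg exp_diff field_simps)
  \<comment> \<open>Reading constant times area as an integral over the cell makes the comparison
    with the radial density pointwise, at each \<open>x\<close> instead of only at the
    centre.\<close>
  also have "\<dots> = (\<integral>\<^sup>+ x\<in>Q. ennreal (l * q * exp (- ((1 - q) * l * measure lborel A + e * measure lborel E))) \<partial>lborel)"
    using Q bounded_cell nonneg q emeasure_bounded_finite[OF bounded_cell]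
    by (subst nn_integral_cmult_indicator) (auto simp: ennreal_mult emeasure_eq_ennreal_measure less_top)
  also have "\<dots> \<le> (\<integral>\<^sup>+ x\<in>Q. ennreal (l * q * exp (C * \<epsilon>)) * ennreal (exp (- (k * pi * (norm x)\<^sup>2))) \<partial>lborel)"
  proof (rule nn_integral_mono)
    fix x :: "real ^ 2"
    have "ennreal (l * q * exp (- ((1 - q) * l * measure lborel A + e * measure lborel E))) \<le>
        ennreal (l * q * exp (C * \<epsilon>)) * ennreal (exp (- (k * pi * (norm x)\<^sup>2)))" if "x \<in> Q"
    proof -
      \<comment> \<open>Cutting the cell and the origin out of the disk costs at most \<pi>
        \<epsilon>^2 of area.\<close>
      have "pi * s\<^sup>2 = measure lborel (ball c s)"
        by (simp add: measure_ball_plane s_def)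
      also have "\<dots> \<le> measure lborel (A \<union> insert 0 Q)"
        using Q meas bounded_cell by (intro measure_mono_fmeasurable fmeasurable_lborel_bounded) (auto simp: A_def)
      also have "\<dots> \<le> measure lborel A + measure lborel (insert 0 Q)"
        using Q meas by (intro measure_Un_le) auto
      also have "measure lborel (insert 0 Q) \<le> measure lborel {0 :: real ^ 2} + measure lborel Q"
        using Q measure_Un_le[of "{0}" lborel Q] by simp
      finally have "pi * s\<^sup>2 - pi * \<epsilon>\<^sup>2 \<le> measure lborel A"
        using measure_cell_le by simp
      then have "k * pi * (norm x)\<^sup>2 - C * \<epsilon> \<le> (1 - q) * l * measure lborel A + e * measure lborel E"
        unfolding C using norm_cell[OF that] nonneg q pos \<epsilon> R k
        by (intro exponent_upper[where r = "norm c"])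
           (auto simp: s_def E_def measure_ball_plane)
      then have "exp (- ((1 - q) * l * measure lborel A + e * measure lborel E)) \<le>
          exp (C * \<epsilon>) * exp (- (k * pi * (norm x)\<^sup>2))"
        unfolding exp_add[symmetric] by simp
      then have "l * q * exp (- ((1 - q) * l * measure lborel A + e * measure lborel E)) \<le>
          l * q * (exp (C * \<epsilon>) * exp (- (k * pi * (norm x)\<^sup>2)))"
        using nonneg q by (intro mult_left_mono) auto
      then show ?thesis
        using nonneg q by (simp add: ennreal_mult[symmetric] ennreal_leI mult.assoc)
    qed
    then show "ennreal (l * q * exp (- ((1 - q) * l * measure lborel A + e * measure lborel E))) * indicator Q x \<le>
        ennreal (l * q * exp (C * \<epsilon>)) * ennreal (exp (- (k * pi * (norm x)\<^sup>2))) * indicator Q x"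
      by (simp add: indicator_def)
  qed
  also have "\<dots> = ennreal (l * q * exp (C * \<epsilon>)) * (\<integral>\<^sup>+ x\<in>Q. ennreal (exp (- (k * pi * (norm x)\<^sup>2))) \<partial>lborel)"
    using Q by (subst nn_integral_cmult[symmetric]) (auto simp: mult.assoc)
  finally show ?thesis .
qed

text \<open>Here the regions must contain all disks of the cell, so the cell cannot simply be
  discarded. Its points are all treated as interferers, which produces \<open>N * q ^ N\<close> for
  the count \<open>N\<close> of the cell and adds the area of \<open>Q\<close> to the
  exponent.\<close>

lemma cell_lower_bound:
  "ennreal (l * q * exp (- (C * \<epsilon>))) * (\<integral>\<^sup>+ x\<in>Q. ennreal (exp (- (k * pi * (norm x)\<^sup>2))) \<partial>lborel) \<le>
    (\<integral>\<^sup>+ \<omega>. (\<Sum>x\<in>\<Phi> \<omega> \<inter> Q. ennreal (link_weight \<beta> \<gamma> q (\<Phi> \<omega>) (\<Psi> \<omega>) x)) \<partial>M)"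
proof -
  define s where "s = \<beta> * norm c + (1 + \<beta>) * \<epsilon>"
  define A where "A = ball c s - Q"
  define E where "E = ball (0 :: real ^ 2) (\<gamma> * (norm c + \<epsilon>))"
  have meas: "A \<in> sets borel" "bounded A" "E \<in> sets borel" "bounded E"
    using Q by (auto simp: A_def E_def intro: bounded_subset[OF bounded_ball[of c s]])
  have s: "0 \<le> s" using pos \<epsilon> by (simp add: s_def)
  have weight: "q ^ card (\<Phi> \<omega> \<inter> Q) * q ^ card (\<Phi> \<omega> \<inter> A) * 0 ^ card (\<Psi> \<omega> \<inter> E) \<le>
      link_weight \<beta> \<gamma> q (\<Phi> \<omega>) (\<Psi> \<omega>) x"
    if \<omega>: "\<omega> \<in> space M" and x: "x \<in> \<Phi> \<omega> \<inter> Q" for \<omega> x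
  proof -
    let ?S = "\<Phi> \<omega> \<inter> insert x (ball x (\<beta> * norm x) - {0})"
    have "ball x (\<beta> * norm x) \<subseteq> ball c s"
    proof
      fix y assume y: "y \<in> ball x (\<beta> * norm x)"
      moreover have "dist c x < \<epsilon>" using x Q by auto
      moreover have "dist c y \<le> dist c x + dist x y" by (rule dist_triangle)
      moreover have "\<beta> * norm x \<le> \<beta> * (norm c + \<epsilon>)"
        using norm_cell[of x] x pos by (intro mult_left_mono) auto
      ultimately show "y \<in> ball c s"
        by (auto simp: algebra_simps s_def)
    qed
    moreover have fin: "finite (\<Phi> \<omega> \<inter> Q)" "finite (\<Phi> \<omega> \<inter> A)"
      using finite_Int_poisson[OF \<Phi> \<omega>] bounded_cell meas by auto
    ultimately have "card ?S \<le> card ((\<Phi> \<omega> \<inter> Q) \<union> (\<Phi> \<omega> \<inter> A))"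
      using x by (intro card_mono) (auto simp: A_def)
    also have "\<dots> \<le> card (\<Phi> \<omega> \<inter> Q) + card (\<Phi> \<omega> \<inter> A)" by (rule card_Un_le)
    finally have "q ^ card (\<Phi> \<omega> \<inter> Q) * q ^ card (\<Phi> \<omega> \<inter> A) \<le> q ^ card ?S"
      using q unfolding power_add[symmetric] by (intro power_decreasing) auto
    moreover have "(0 :: real) ^ card (\<Psi> \<omega> \<inter> E) \<le> of_bool (\<Psi> \<omega> \<inter> ball 0 (\<gamma> * norm x) = {})"
    proof -
      have "ball 0 (\<gamma> * norm x) \<subseteq> E"
        unfolding E_def using norm_cell[of x] x pos by (intro subset_ball mult_left_mono) auto
      \<comment> \<open>Infinite sets have \<open>card\<close> 0, so local finiteness is what makes
        a zero count mean emptiness.\<close>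
      then have "\<Psi> \<omega> \<inter> ball 0 (\<gamma> * norm x) = {}" if "card (\<Psi> \<omega> \<inter> E) = 0"
        using that finite_Int_poisson[OF \<Psi> \<omega> meas(4)] by auto
      then show ?thesis by (auto simp: power_0_left)
    qed
    ultimately show ?thesis
      unfolding link_weight_def using q by (intro mult_mono) auto
  qed
  have "ennreal (l * q * exp (- (C * \<epsilon>))) * (\<integral>\<^sup>+ x\<in>Q. ennreal (exp (- (k * pi * (norm x)\<^sup>2))) \<partial>lborel) =
      (\<integral>\<^sup>+ x\<in>Q. ennreal (l * q * exp (- (C * \<epsilon>))) * ennreal (exp (- (k * pi * (norm x)\<^sup>2))) \<partial>lborel)"
    using Q by (subst nn_integral_cmult[symmetric]) (auto simp: mult.assoc)
  also have "\<dots> \<le> (\<integral>\<^sup>+ x\<in>Q. ennreal (l * q * exp (- ((1 - q) * l * (measure lborel A + measure lborel Q) + e * measure lborel E))) \<partial>lborel)"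
  proof (rule nn_integral_mono)
    fix x :: "real ^ 2"
    have "ennreal (l * q * exp (- (C * \<epsilon>))) * ennreal (exp (- (k * pi * (norm x)\<^sup>2))) \<le>
        ennreal (l * q * exp (- ((1 - q) * l * (measure lborel A + measure lborel Q) + e * measure lborel E)))" if "x \<in> Q"
    proof -
      have "measure lborel A \<le> measure lborel (ball c s)"
        using Q meas by (intro measure_mono_fmeasurable fmeasurable_lborel_bounded) (auto simp: A_def)
      then have "measure lborel A + measure lborel Q \<le> pi * s\<^sup>2 + pi * \<epsilon>\<^sup>2"
        using measure_cell_le s by (simp add: measure_ball_plane)
      then have "(1 - q) * l * (measure lborel A + measure lborel Q) + e * measure lborel E \<le>
          k * pi * (norm x)\<^sup>2 + C * \<epsilon>"
        unfolding C using norm_cell[OF that] nonneg q pos \<epsilon> R k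
        by (intro exponent_lower[where r = "norm c"])
           (auto simp: s_def E_def measure_ball_plane)
      then have "exp (- (C * \<epsilon>)) * exp (- (k * pi * (norm x)\<^sup>2)) \<le>
          exp (- ((1 - q) * l * (measure lborel A + measure lborel Q) + e * measure lborel E))"
        unfolding exp_add[symmetric] by simp
      then have "l * q * (exp (- (C * \<epsilon>)) * exp (- (k * pi * (norm x)\<^sup>2))) \<le>
          l * q * exp (- ((1 - q) * l * (measure lborel A + measure lborel Q) + e * measure lborel E))"
        using nonneg q by (intro mult_left_mono) auto
      then show ?thesis
        using nonneg q by (simp add: ennreal_mult[symmetric] ennreal_leI mult.assoc)
    qed
    then show "ennreal (l * q * exp (- (C * \<epsilon>))) * ennreal (exp (- (k * pi * (norm x)\<^sup>2))) * indicator Q x \<le>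
        ennreal (l * q * exp (- ((1 - q) * l * (measure lborel A + measure lborel Q) + e * measure lborel E))) * indicator Q x"
      by (simp add: indicator_def)
  qed
  also have "\<dots> = ennreal (l * q * exp (- ((1 - q) * l * (measure lborel A + measure lborel Q) + e * measure lborel E)) * measure lborel Q)"
    using Q bounded_cell nonneg q emeasure_bounded_finite[OF bounded_cell]
    by (subst nn_integral_cmult_indicator) (auto simp: ennreal_mult emeasure_eq_ennreal_measure less_top)
  also have "\<dots> = (\<integral>\<^sup>+ \<omega>. ennreal (card (\<Phi> \<omega> \<inter> Q) * q ^ card (\<Phi> \<omega> \<inter> Q) *
        q ^ card (\<Phi> \<omega> \<inter> A) * 0 ^ card (\<Psi> \<omega> \<inter> E)) \<partial>M)"
  proof (subst nn_integral_poisson_pair[OF \<Phi> \<Psi> indep])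
    have "exp (- ((1 - q) * l * (measure lborel A + measure lborel Q) + e * measure lborel E)) =
        exp (- ((1 - q) * (l * measure lborel Q))) * exp (- ((1 - q) * (l * measure lborel A))) *
        exp (- (e * measure lborel E))"
      unfolding exp_add[symmetric] by (simp add: algebra_simps)
    then show "ennreal (l * q * exp (- ((1 - q) * l * (measure lborel A + measure lborel Q) + e * measure lborel E)) * measure lborel Q) =
      ennreal (q * (l * measure lborel Q) * exp (- ((1 - q) * (l * measure lborel Q))) *
        exp (- ((1 - q) * (l * measure lborel A))) * exp (- (e * measure lborel E)))"
      by (simp add: mult_ac)
  qed (use nonneg q Q meas bounded_cell in \<open>auto simp: A_def\<close>)
  also have "\<dots> \<le> (\<integral>\<^sup>+ \<omega>. (\<Sum>x\<in>\<Phi> \<omega> \<inter> Q. ennreal (link_weight \<beta> \<gamma> q (\<Phi> \<omega>) (\<Psi> \<omega>) x)) \<partial>M)"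
  proof (rule nn_integral_mono)
    fix \<omega> assume \<omega>: "\<omega> \<in> space M"
    have "ennreal (card (\<Phi> \<omega> \<inter> Q) * q ^ card (\<Phi> \<omega> \<inter> Q) * q ^ card (\<Phi> \<omega> \<inter> A) * 0 ^ card (\<Psi> \<omega> \<inter> E)) =
        (\<Sum>x\<in>\<Phi> \<omega> \<inter> Q. ennreal (q ^ card (\<Phi> \<omega> \<inter> Q) * q ^ card (\<Phi> \<omega> \<inter> A) * 0 ^ card (\<Psi> \<omega> \<inter> E)))"
      using q by (simp add: ennreal_mult ennreal_of_nat_eq_real_of_nat mult_ac)
    also have "\<dots> \<le> (\<Sum>x\<in>\<Phi> \<omega> \<inter> Q. ennreal (link_weight \<beta> \<gamma> q (\<Phi> \<omega>) (\<Psi> \<omega>) x))"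
      using weight[OF \<omega>] by (intro sum_mono ennreal_leI) auto
    finally show "ennreal (card (\<Phi> \<omega> \<inter> Q) * q ^ card (\<Phi> \<omega> \<inter> Q) * q ^ card (\<Phi> \<omega> \<inter> A) *
        0 ^ card (\<Psi> \<omega> \<inter> E)) \<le> \<dots>" .
  qed
  finally show ?thesis .
qed
end
end

section \<open>Partition of the disk into cells and the limit of small cells\<close>

text \<open>A finite subcover of the compact disk by \<epsilon>-balls, made disjoint by subtracting
  the earlier balls. The centres stay in the closed disk, so that the error constant with
  \<open>R = \<eta>\<close> is common to all cells.\<close>

lemma finite_partition_ball:
  fixes \<eta> \<epsilon> :: real
  assumes "0 < \<epsilon>"
  obtains c :: "nat \<Rightarrow> 'a::euclidean_space" and n :: nat and Q :: "nat \<Rightarrow> 'a set"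
  where "\<And>i. i < n \<Longrightarrow> norm (c i) \<le> \<eta>" "\<And>i. Q i \<in> sets borel" "\<And>i. Q i \<subseteq> ball (c i) \<epsilon>"
    "disjoint_family Q" "(\<Union>i<n. Q i) = ball 0 \<eta>"
proof -
  have "cball (0::'a) \<eta> \<subseteq> (\<Union>x\<in>cball 0 \<eta>. ball x \<epsilon>)"
    using assms by (auto intro!: bexI)
  then obtain K where K: "K \<subseteq> cball (0::'a) \<eta>" "finite K" "cball 0 \<eta> \<subseteq> (\<Union>x\<in>K. ball x \<epsilon>)"
    by (rule compactE_image[OF compact_cball open_ball])
  obtain c where c: "bij_betw c {0..<card K} K"
    using ex_bij_betw_nat_finite[OF K(2)] by blast
  define Q where "Q i = ball 0 \<eta> \<inter> disjointed (\<lambda>j. ball (c j) \<epsilon>) i" for i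
  have "(\<Union>i<card K. Q i) = ball 0 \<eta> \<inter> (\<Union>i\<in>{0..<card K}. disjointed (\<lambda>j. ball (c j) \<epsilon>) i)"
    by (auto simp: Q_def)
  also have "\<dots> = ball 0 \<eta> \<inter> (\<Union>x\<in>c ` {0..<card K}. ball x \<epsilon>)"
    by (simp only: finite_UN_disjointed_eq image_image)
  also have "c ` {0..<card K} = K"
    using c by (rule bij_betw_imp_surj_on)
  also have "ball 0 \<eta> \<inter> (\<Union>x\<in>K. ball x \<epsilon>) = ball 0 \<eta>"
    using K(3) ball_subset_cball[of 0 \<eta>] by blast
  finally have UN: "(\<Union>i<card K. Q i) = ball 0 \<eta>" .
  have norm: "norm (c i) \<le> \<eta>" if "i < card K" for i
  proof -
    have "c i \<in> K" using bij_betwE[OF c] that by simp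
    then show ?thesis using K(1) by auto
  qed
  have sets: "Q i \<in> sets borel" for i
    unfolding Q_def disjointed_def by auto
  have sub: "Q i \<subseteq> ball (c i) \<epsilon>" for i
    using disjointed_subset[of "\<lambda>j. ball (c j) \<epsilon>" i] by (auto simp: Q_def)
  have disj: "disjoint_family Q"
    using disjoint_family_disjointed[of "\<lambda>j. ball (c j) \<epsilon>"]
    by (auto simp: disjoint_family_on_def Q_def)
  show ?thesis by (rule that[OF norm sets sub disj UN])
qed

text \<open>The factors exp (\<plusminus> C \<epsilon>) do not depend on the cell, so the cell
  bounds add up to multiples of the radial integral over the disk, and \<epsilon> tends to 0.
  Measurability of the partial sums is assumed, to be supplied later by an enumeration of the
  points.\<close>

lemma (in poisson_pair) nn_integral_sum_link_weight:
  fixes q \<beta> \<gamma> \<eta> k :: real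
  assumes q: "0 \<le> q" "q \<le> 1" and pos: "0 < \<beta>" "0 < \<gamma>" "0 < \<eta>"
    and k: "k = (1 - q) * l * \<beta>\<^sup>2 + e * \<gamma>\<^sup>2" "0 < k"
    and meas: "\<And>Q. Q \<in> sets borel \<Longrightarrow> Q \<subseteq> ball 0 \<eta> \<Longrightarrow>
      (\<lambda>\<omega>. \<Sum>x\<in>\<Phi> \<omega> \<inter> Q. ennreal (link_weight \<beta> \<gamma> q (\<Phi> \<omega>) (\<Psi> \<omega>) x)) \<in> borel_measurable M"
  shows "(\<integral>\<^sup>+ \<omega>. (\<Sum>x\<in>\<Phi> \<omega> \<inter> ball 0 \<eta>. ennreal (link_weight \<beta> \<gamma> q (\<Phi> \<omega>) (\<Psi> \<omega>) x)) \<partial>M) =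
    ennreal (l * q * ((1 - exp (- (k * pi * \<eta>\<^sup>2))) / k))"
proof -
  define W where "W \<omega> Q = (\<Sum>x\<in>\<Phi> \<omega> \<inter> Q. ennreal (link_weight \<beta> \<gamma> q (\<Phi> \<omega>) (\<Psi> \<omega>) x))" for \<omega> Q
  define g where "g x = ennreal (exp (- (k * pi * (norm (x :: real ^ 2))\<^sup>2)))" for x
  define C where "C = pi * ((1 - q) * l * (2 * \<beta> * \<eta> * (1 + \<beta>) + (1 + \<beta>)\<^sup>2 + 1) + e * \<gamma>\<^sup>2 * (2 * \<eta> + 1) + k * (2 * \<eta> + 3))"
  define v where "v = (1 - exp (- (k * pi * \<eta>\<^sup>2))) / k"
  have [measurable]: "g \<in> borel_measurable borel" unfolding g_def by measurable
  have v: "0 \<le> v" using k pos by (simp add: v_def)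
  have g: "(\<integral>\<^sup>+ x\<in>ball 0 \<eta>. g x \<partial>lborel) = ennreal v"
    using nn_integral_ball_exp_norm_square[OF pos(3) k(2)] by (simp add: g_def v_def)
  have bounds: "ennreal (l * q * exp (- (C * \<epsilon>)) * v) \<le> (\<integral>\<^sup>+ \<omega>. W \<omega> (ball 0 \<eta>) \<partial>M)"
    "(\<integral>\<^sup>+ \<omega>. W \<omega> (ball 0 \<eta>) \<partial>M) \<le> ennreal (l * q * exp (C * \<epsilon>) * v)"
    if \<epsilon>: "0 < \<epsilon>" "\<epsilon> \<le> 1" for \<epsilon>
  proof -
    obtain c :: "nat \<Rightarrow> real ^ 2" and n Q where cQ: "\<And>i. i < n \<Longrightarrow> norm (c i) \<le> \<eta>"
      "\<And>i. Q i \<in> sets borel" "\<And>i. Q i \<subseteq> ball (c i) \<epsilon>" "disjoint_family Q" "(\<Union>i<n. Q i) = ball 0 \<eta>"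
      by (rule finite_partition_ball[OF \<epsilon>(1), of \<eta>]) (rule that)
    have "W \<omega> (ball 0 \<eta>) = (\<Sum>i<n. W \<omega> (Q i))" if "\<omega> \<in> space M" for \<omega>
    proof -
      have "finite (\<Phi> \<omega> \<inter> Q i)" for i
        using finite_Int_poisson[OF \<Phi> that bounded_subset[OF bounded_ball cQ(3)]] .
      moreover have "\<Phi> \<omega> \<inter> ball 0 \<eta> = (\<Union>i\<in>{..<n}. \<Phi> \<omega> \<inter> Q i)"
        by (simp only: cQ(5)[symmetric] Int_UN_distrib)
      moreover have "\<forall>i\<in>{..<n}. \<forall>j\<in>{..<n}. i \<noteq> j \<longrightarrow> (\<Phi> \<omega> \<inter> Q i) \<inter> (\<Phi> \<omega> \<inter> Q j) = {}"
        using disjoint_family_onD[OF cQ(4)] by blast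
      ultimately show ?thesis
        unfolding W_def by (simp only:) (rule sum.UNION_disjoint; simp)
    qed
    then have "(\<integral>\<^sup>+ \<omega>. W \<omega> (ball 0 \<eta>) \<partial>M) = (\<integral>\<^sup>+ \<omega>. (\<Sum>i<n. W \<omega> (Q i)) \<partial>M)"
      by (intro nn_integral_cong)
    also have "\<dots> = (\<Sum>i<n. \<integral>\<^sup>+ \<omega>. W \<omega> (Q i) \<partial>M)"
      unfolding W_def using cQ by (intro nn_integral_sum meas) auto
    finally have WQ: "(\<integral>\<^sup>+ \<omega>. W \<omega> (ball 0 \<eta>) \<partial>M) = \<dots>" .
    have "(\<integral>\<^sup>+ x\<in>ball 0 \<eta>. g x \<partial>lborel) = (\<integral>\<^sup>+ x. (\<Sum>i<n. g x * indicator (Q i) x) \<partial>lborel)"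
      using cQ(4) unfolding cQ(5)[symmetric]
      by (intro nn_integral_cong)
         (simp add: indicator_UN_disjoint disjoint_family_on_def sum_distrib_left)
    also have "\<dots> = (\<Sum>i<n. \<integral>\<^sup>+ x\<in>Q i. g x \<partial>lborel)"
    proof (rule nn_integral_sum)
      note [measurable] = cQ(2)
      show "(\<lambda>x. g x * indicator (Q i) x) \<in> borel_measurable lborel" for i by measurable
    qed
    finally have gQ: "ennreal v = \<dots>" unfolding g .
    have "(\<integral>\<^sup>+ \<omega>. W \<omega> (ball 0 \<eta>) \<partial>M) \<le> (\<Sum>i<n. ennreal (l * q * exp (C * \<epsilon>)) * (\<integral>\<^sup>+ x\<in>Q i. g x \<partial>lborel))"
      unfolding WQ unfolding W_def g_def
      using cQ(1) by (intro sum_mono cell_upper_bound[OF q pos(1,2) \<epsilon> cQ(2,3) _ k(1) C_def]) auto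
    then show "(\<integral>\<^sup>+ \<omega>. W \<omega> (ball 0 \<eta>) \<partial>M) \<le> ennreal (l * q * exp (C * \<epsilon>) * v)"
      using v nonneg q by (simp add: sum_distrib_left[symmetric] gQ[symmetric] ennreal_mult)
    have "(\<Sum>i<n. ennreal (l * q * exp (- (C * \<epsilon>))) * (\<integral>\<^sup>+ x\<in>Q i. g x \<partial>lborel)) \<le> (\<integral>\<^sup>+ \<omega>. W \<omega> (ball 0 \<eta>) \<partial>M)"
      unfolding WQ unfolding W_def g_def
      using cQ(1) by (intro sum_mono cell_lower_bound[OF q pos(1,2) \<epsilon> cQ(2,3) _ k(1) C_def]) auto
    then show "ennreal (l * q * exp (- (C * \<epsilon>)) * v) \<le> (\<integral>\<^sup>+ \<omega>. W \<omega> (ball 0 \<eta>) \<partial>M)"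
      using v nonneg q by (simp add: sum_distrib_left[symmetric] gQ[symmetric] ennreal_mult)
  qed
  \<comment> \<open>The upper bound for \<epsilon> = 1 shows that the expectation is finite; the
    squeeze can then be carried out in the reals, with \<epsilon> =
    \<open>1 / Suc n\<close>.\<close>
  obtain w where w: "(\<integral>\<^sup>+ \<omega>. W \<omega> (ball 0 \<eta>) \<partial>M) = ennreal w" "0 \<le> w"
    using bounds(2)[of 1] by (cases "\<integral>\<^sup>+ \<omega>. W \<omega> (ball 0 \<eta>) \<partial>M") (auto simp: top_unique)
  have w_bounds: "l * q * exp (- (C * (1 / Suc n))) * v \<le> w" "w \<le> l * q * exp (C * (1 / Suc n)) * v" for n
    using bounds[of "1 / Suc n"] v nonneg q w by auto
  have lim: "(\<lambda>n. C * (1 / Suc n)) \<longlonglongrightarrow> C * 0"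
    by (intro tendsto_intros LIMSEQ_Suc[OF lim_1_over_n])
  have "(\<lambda>n. l * q * exp (- (C * (1 / Suc n))) * v) \<longlonglongrightarrow> l * q * exp (- (C * 0)) * v"
    by (intro tendsto_intros lim)
  then have "l * q * v \<le> w"
    using w_bounds(1) by (intro LIMSEQ_le_const2) auto
  moreover have "(\<lambda>n. l * q * exp (C * (1 / Suc n)) * v) \<longlonglongrightarrow> l * q * exp (C * 0) * v"
    by (intro tendsto_intros lim)
  then have "w \<le> l * q * v"
    using w_bounds(2) by (intro LIMSEQ_le_const) auto
  ultimately have "w = l * q * v" by simp
  with w(1) show ?thesis by (simp add: W_def v_def)
qed

section \<open>Enumerated points: measurability and the degree as a series\<close>

text \<open>This trades a random index set for a fixed one, so that sums can be handled term by
  term. The number \<open>K\<close> of points may be infinite although only finitely many lie in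
  \<open>Q\<close>.\<close>

lemma sum_enumeration:
  fixes f :: "'a \<Rightarrow> ennreal"
  assumes bij: "bij_betw x {n. enat n < K} S" and fin: "finite (S \<inter> Q)"
  shows "(\<Sum>y\<in>S \<inter> Q. f y) = (\<Sum>n. if enat n < K \<and> x n \<in> Q then f (x n) else 0)"
proof -
  let ?I = "{n. enat n < K \<and> x n \<in> Q}"
  have im: "S \<inter> Q = x ` ?I"
    using bij_betw_imp_surj_on[OF bij] by auto
  have inj: "inj_on x ?I"
    using bij by (auto simp: bij_betw_def inj_on_def)
  have "finite ?I" using fin unfolding im by (rule finite_imageD[OF _ inj])
  then have "(\<Sum>n. if enat n < K \<and> x n \<in> Q then f (x n) else 0) = (\<Sum>n\<in>?I. f (x n))"
    by (subst suminf_finite[of ?I]) auto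
  then show ?thesis unfolding im by (simp add: sum.reindex[OF inj])
qed

text \<open>The configuration space measures counts in fixed sets, but here the radius is random. An
  open ball is exhausted by the balls of smaller rational radius, which leaves countably many
  conditions on fixed counts.\<close>

lemma pred_void_ball:
  fixes \<Psi> :: "'w \<Rightarrow> 'a::euclidean_space set"
  assumes \<Psi> [measurable]: "\<Psi> \<in> measurable M config_space" and r [measurable]: "r \<in> borel_measurable M"
  shows "Measurable.pred M (\<lambda>\<omega>. \<Psi> \<omega> \<inter> ball 0 (r \<omega>) = {})"
proof -
  have *: "\<Psi> \<omega> \<inter> ball 0 (r \<omega>) = {} \<longleftrightarrow> (\<forall>s::rat. of_rat s < r \<omega> \<longrightarrow> card (\<Psi> \<omega> \<inter> ball 0 (of_rat s)) = 0)"
    if \<omega>: "\<omega> \<in> space M" for \<omega>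
  proof
    assume "\<Psi> \<omega> \<inter> ball 0 (r \<omega>) = {}"
    then have "\<Psi> \<omega> \<inter> ball 0 (of_rat s) = {}" if "of_rat s < r \<omega>" for s :: rat
      using that by (fastforce simp: set_eq_iff)
    then show "\<forall>s::rat. of_rat s < r \<omega> \<longrightarrow> card (\<Psi> \<omega> \<inter> ball 0 (of_rat s)) = 0" by simp
  next
    assume card: "\<forall>s::rat. of_rat s < r \<omega> \<longrightarrow> card (\<Psi> \<omega> \<inter> ball 0 (of_rat s)) = 0"
    have False if x: "x \<in> \<Psi> \<omega>" "norm x < r \<omega>" for x
    proof -
      obtain s where s: "norm x < of_rat s" "of_rat s < r \<omega>"
        using of_rat_dense[OF x(2)] by blast
      have "finite (\<Psi> \<omega> \<inter> ball 0 (of_rat s))"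
        using measurable_space[OF \<Psi> \<omega>] by (simp add: space_config_space locally_finite_set_def)
      moreover have "card (\<Psi> \<omega> \<inter> ball 0 (of_rat s)) = 0" using card s(2) by blast
      ultimately have "\<Psi> \<omega> \<inter> ball 0 (of_rat s) = {}" by simp
      with x(1) s(1) show False by auto
    qed
    then show "\<Psi> \<omega> \<inter> ball 0 (r \<omega>) = {}" by auto
  qed
  have [measurable]: "(\<lambda>S. card (S \<inter> ball (0::'a) t)) \<in> measurable config_space (count_space UNIV)" for t
    by (rule measurable_card_Int_config_space) auto
  have "Measurable.pred M (\<lambda>\<omega>. \<forall>s::rat. of_rat s < r \<omega> \<longrightarrow> card (\<Psi> \<omega> \<inter> ball 0 (of_rat s)) = 0)"
    by measurable
  then show ?thesis
    by (rule measurable_cong[THEN iffD2, rotated]) (rule *)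
qed

text \<open>The indices of the points that must not transmit in order that the \<open>n\<close>-th point receives
  the message of the origin.\<close>
definition interferers :: "real \<Rightarrow> enat \<Rightarrow> (nat \<Rightarrow> real ^ 2) \<Rightarrow> nat \<Rightarrow> nat set" where
  "interferers \<beta> K x n = insert n {m. enat m < K \<and> x m \<in> ball (x n) (\<beta> * norm (x n)) - {0}}"

lemma card_interferers:
  assumes bij: "bij_betw x {n. enat n < K} S" and n: "enat n < K"
  shows "card (interferers \<beta> K x n) = card (S \<inter> insert (x n) (ball (x n) (\<beta> * norm (x n)) - {0}))"
proof (rule bij_betw_same_card)
  have sub: "interferers \<beta> K x n \<subseteq> {n. enat n < K}" using n by (auto simp: interferers_def)
  have "x ` interferers \<beta> K x n = S \<inter> insert (x n) (ball (x n) (\<beta> * norm (x n)) - {0})"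
    using bij_betw_imp_surj_on[OF bij] n by (auto simp: interferers_def)
  then show "bij_betw x (interferers \<beta> K x n) (S \<inter> insert (x n) (ball (x n) (\<beta> * norm (x n)) - {0}))"
    using bij_betw_subset[OF bij sub] by simp
qed

lemma finite_interferers:
  assumes bij: "bij_betw x {n. enat n < K} S" and n: "enat n < K" and S: "locally_finite_set S"
  shows "finite (interferers \<beta> K x n)"
proof -
  have sub: "interferers \<beta> K x n \<subseteq> {n. enat n < K}" using n by (auto simp: interferers_def)
  have "x ` interferers \<beta> K x n \<subseteq> S \<inter> insert (x n) (ball (x n) (\<beta> * norm (x n)))"
    using bij_betw_imp_surj_on[OF bij] n by (auto simp: interferers_def)
  moreover have "finite \<dots>"
    using S by (simp add: locally_finite_set_def)
  ultimately have "finite (x ` interferers \<beta> K x n)"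
    by (rule finite_subset)
  moreover have "inj_on x (interferers \<beta> K x n)"
    using bij sub by (auto simp: bij_betw_def intro: inj_on_subset)
  ultimately show ?thesis by (rule finite_imageD)
qed

lemma pred_interferers:
  assumes [measurable]: "K \<in> measurable M (count_space UNIV)" "\<And>n. X n \<in> borel_measurable M"
  shows "Measurable.pred M (\<lambda>\<omega>. m \<in> interferers \<beta> (K \<omega>) (\<lambda>n. X n \<omega>) n)"
proof -
  have "Measurable.pred M (\<lambda>\<omega>. m = n \<or> enat m < K \<omega> \<and> dist (X n \<omega>) (X m \<omega>) < \<beta> * norm (X n \<omega>) \<and> X m \<omega> \<noteq> 0)"
    by measurable
  then show ?thesis by (simp add: interferers_def)
qed

text \<open>A receiver must itself be unmarked, and so must its interferers. Since \<open>n\<close>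
  belongs to its own set of interferers, both requirements merge into one event of the kind treated
  in \<open>emeasure_no_marks\<close>.\<close>

lemma secure_out_degree_enumeration:
  assumes bij: "bij_betw x {n. enat n < K} S" and S: "locally_finite_set S"
    and T: "T = {x n | n. enat n < K \<and> b n}"
  shows "ennreal (secure_out_degree \<eta> \<beta> \<gamma> T (S - T) E) =
    (\<Sum>n. of_bool (enat n < K \<and> norm (x n) < \<eta> \<and> E \<inter> ball 0 (\<gamma> * norm (x n)) = {} \<and>
      (\<forall>m\<in>interferers \<beta> K x n. \<not> b m)))"
proof -
  \<comment> \<open>The condition of being a receiver is moved from the index set into the summand,
    so that the sum runs over the enumerated set \<open>S\<close>.\<close>
  define f where "f y = (of_bool (y \<notin> T \<and> single_hop \<eta> \<beta> (insert 0 T) 0 y \<and> E \<inter> ball 0 (\<gamma> * norm y) = {}) :: real)" for y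
  have fin: "finite (S \<inter> ball 0 \<eta>)" using S by (simp add: locally_finite_set_def)
  have "secure_out_degree \<eta> \<beta> \<gamma> T (S - T) E = (\<Sum>\<^sub>\<infinity>y\<in>S \<inter> ball 0 \<eta>. f y)"
    unfolding secure_out_degree_def
    by (rule infsum_cong_neutral) (auto simp: f_def single_hop_def)
  also have "\<dots> = (\<Sum>y\<in>S \<inter> ball 0 \<eta>. f y)"
    using fin by (rule infsum_finite)
  finally have "ennreal (secure_out_degree \<eta> \<beta> \<gamma> T (S - T) E) = (\<Sum>y\<in>S \<inter> ball 0 \<eta>. ennreal (f y))"
    by (simp add: f_def)
  also have "\<dots> = (\<Sum>n. if enat n < K \<and> x n \<in> ball 0 \<eta> then ennreal (f (x n)) else 0)"
    by (rule sum_enumeration[OF bij fin])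
  also have "\<dots> = (\<Sum>n. of_bool (enat n < K \<and> norm (x n) < \<eta> \<and> E \<inter> ball 0 (\<gamma> * norm (x n)) = {} \<and>
      (\<forall>m\<in>interferers \<beta> K x n. \<not> b m)))"
  proof (rule suminf_cong)
    fix n
    \<comment> \<open>Without repetitions in the enumeration, a point lies in \<open>T\<close>
      exactly if its own mark is set.\<close>
    have inj: "m = m'" if "x m = x m'" "enat m < K" "enat m' < K" for m m'
      using bij that by (auto simp: bij_betw_def inj_on_def)
    have "f (x n) = of_bool (E \<inter> ball 0 (\<gamma> * norm (x n)) = {} \<and> (\<forall>m\<in>interferers \<beta> K x n. \<not> b m))"
      if n: "enat n < K" "norm (x n) < \<eta>"
    proof -
      have "x n \<notin> T \<longleftrightarrow> \<not> b n"
        using n(1) inj unfolding T by blast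
      moreover have "single_hop \<eta> \<beta> (insert 0 T) 0 (x n) \<longleftrightarrow>
          (\<forall>m. enat m < K \<and> x m \<in> ball (x n) (\<beta> * norm (x n)) - {0} \<longrightarrow> \<not> b m)"
        using n(2) unfolding single_hop_def T by auto
      ultimately show ?thesis
        unfolding f_def interferers_def by auto
    qed
    then show "(if enat n < K \<and> x n \<in> ball 0 \<eta> then ennreal (f (x n)) else 0) =
      of_bool (enat n < K \<and> norm (x n) < \<eta> \<and> E \<inter> ball 0 (\<gamma> * norm (x n)) = {} \<and>
        (\<forall>m\<in>interferers \<beta> K x n. \<not> b m))"
      by auto
  qed
  finally show ?thesis .
qed

text \<open>Each weight contains a count in a disk that moves with the point. Along the enumeration
  this count is the size of a random index set whose membership events are measurable.\<close>

lemma measurable_sum_link_weight: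
  fixes \<Phi> \<Psi> :: "'w \<Rightarrow> (real ^ 2) set"
  assumes K [measurable]: "K \<in> measurable M (count_space UNIV)" and X [measurable]: "\<And>n. X n \<in> borel_measurable M"
    and bij: "\<And>\<omega>. \<omega> \<in> space M \<Longrightarrow> bij_betw (\<lambda>n. X n \<omega>) {n. enat n < K \<omega>} (\<Phi> \<omega>)"
    and \<Psi>: "\<Psi> \<in> measurable M config_space"
    and Q [measurable]: "Q \<in> sets borel" and fin: "\<And>\<omega>. \<omega> \<in> space M \<Longrightarrow> finite (\<Phi> \<omega> \<inter> Q)"
  shows "(\<lambda>\<omega>. \<Sum>x\<in>\<Phi> \<omega> \<inter> Q. ennreal (link_weight \<beta> \<gamma> q (\<Phi> \<omega>) (\<Psi> \<omega>) x)) \<in> borel_measurable M"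
proof -
  let ?J = "\<lambda>n \<omega>. interferers \<beta> (K \<omega>) (\<lambda>n. X n \<omega>) n"
  have [measurable]: "Measurable.pred M (\<lambda>\<omega>. \<Psi> \<omega> \<inter> ball 0 (\<gamma> * norm (X n \<omega>)) = {})" for n
    by (rule pred_void_ball[OF \<Psi>]) measurable
  have [measurable]: "(\<lambda>\<omega>. card (?J n \<omega>)) \<in> measurable M (count_space UNIV)" for n
    using pred_interferers[OF K X] by (intro measurable_card) (simp add: pred_def)
  have "(\<lambda>\<omega>. \<Sum>n. if enat n < K \<omega> \<and> X n \<omega> \<in> Q
      then ennreal (q ^ card (?J n \<omega>) * of_bool (\<Psi> \<omega> \<inter> ball 0 (\<gamma> * norm (X n \<omega>)) = {})) else 0)
      \<in> borel_measurable M"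
    unfolding of_bool_def by measurable
  then show ?thesis
    by (rule measurable_cong[THEN iffD2, rotated])
       (simp add: sum_enumeration[OF bij fin] link_weight_def card_interferers[OF bij]
         del: Int_insert_right Int_insert_right_if0 Int_insert_right_if1 cong: if_cong)
qed

theorem theorem1:
  fixes M :: "'w measure"
    and \<Phi>\<^sub>l \<Phi>\<^sub>e \<Phi>\<^sub>t :: "'w \<Rightarrow> (real ^ 2) set"
    and p \<eta> \<beta>\<^sub>l \<beta>\<^sub>e lam\<^sub>l lam\<^sub>e :: real
  assumes "prob_space M"
    and "0 < p" "p < 1"
    and "0 < \<eta>" "0 < \<beta>\<^sub>l" "0 < \<beta>\<^sub>e"
    and "0 \<le> lam\<^sub>l" "0 \<le> lam\<^sub>e"
    and "0 < lam\<^sub>l * p * \<beta>\<^sub>l\<^sup>2 + lam\<^sub>e * \<beta>\<^sub>e\<^sup>2"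
    and "poisson_point_process M lam\<^sub>l \<Phi>\<^sub>l"
    and "poisson_point_process M lam\<^sub>e \<Phi>\<^sub>e"
    and "prob_space.indep_var M config_space \<Phi>\<^sub>l config_space \<Phi>\<^sub>e"
    and "independent_thinning M p \<Phi>\<^sub>l config_space \<Phi>\<^sub>e \<Phi>\<^sub>t"
  shows "integrable M (\<lambda>\<omega>. secure_out_degree \<eta> \<beta>\<^sub>l \<beta>\<^sub>e (\<Phi>\<^sub>t \<omega>) (\<Phi>\<^sub>l \<omega> - \<Phi>\<^sub>t \<omega>) (\<Phi>\<^sub>e \<omega>)) \<and>
    prob_space.expectation M
      (\<lambda>\<omega>. secure_out_degree \<eta> \<beta>\<^sub>l \<beta>\<^sub>e (\<Phi>\<^sub>t \<omega>) (\<Phi>\<^sub>l \<omega> - \<Phi>\<^sub>t \<omega>) (\<Phi>\<^sub>e \<omega>)) =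
    lam\<^sub>l * (1 - p) * (1 - exp (- ((lam\<^sub>l * p * \<beta>\<^sub>l\<^sup>2 + lam\<^sub>e * \<beta>\<^sub>e\<^sup>2) * pi * \<eta>\<^sup>2))) /
      (lam\<^sub>l * p * \<beta>\<^sub>l\<^sup>2 + lam\<^sub>e * \<beta>\<^sub>e\<^sup>2)"
proof -
  interpret poisson_pair M \<Phi>\<^sub>l \<Phi>\<^sub>e lam\<^sub>l lam\<^sub>e
    using assms by (simp add: poisson_pair_def poisson_pair_axioms_def)
  let ?N = "count_space UNIV \<Otimes>\<^sub>M (\<Pi>\<^sub>M n\<in>UNIV. borel) \<Otimes>\<^sub>M config_space :: (enat \<times> (nat \<Rightarrow> real ^ 2) \<times> (real ^ 2) set) measure"
  let ?deg = "\<lambda>\<omega>. secure_out_degree \<eta> \<beta>\<^sub>l \<beta>\<^sub>e (\<Phi>\<^sub>t \<omega>) (\<Phi>\<^sub>l \<omega> - \<Phi>\<^sub>t \<omega>) (\<Phi>\<^sub>e \<omega>)"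
  obtain K X and B :: "nat \<Rightarrow> 'w \<Rightarrow> bool" where
    enum: "enumerates M \<Phi>\<^sub>l K X" and B: "indep_vars (\<lambda>_. count_space UNIV) B UNIV"
    and p: "\<And>n. prob {\<omega> \<in> space M. B n \<omega>} = p"
    and BZ: "indep_elements M (\<Pi>\<^sub>M n\<in>UNIV. count_space UNIV) (\<lambda>\<omega> n. B n \<omega>) ?N (\<lambda>\<omega>. (K \<omega>, (\<lambda>n. X n \<omega>), \<Phi>\<^sub>e \<omega>))"
    and \<Phi>\<^sub>t: "\<And>\<omega>. \<omega> \<in> space M \<Longrightarrow> \<Phi>\<^sub>t \<omega> = {X n \<omega> | n. enat n < K \<omega> \<and> B n \<omega>}"
    using assms(13) unfolding independent_thinning_def by blast
  have K [measurable]: "K \<in> measurable M (count_space UNIV)" and X [measurable]: "\<And>n. X n \<in> borel_measurable M"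
    and bij: "\<And>\<omega>. \<omega> \<in> space M \<Longrightarrow> bij_betw (\<lambda>n. X n \<omega>) {n. enat n < K \<omega>} (\<Phi>\<^sub>l \<omega>)"
    using enum by (auto simp: enumerates_def)
  have [measurable]: "B n \<in> measurable M (count_space UNIV)" for n
    using B by (auto simp: indep_vars_def)
  have \<Phi>\<^sub>e: "\<Phi>\<^sub>e \<in> measurable M config_space"
    using \<Psi> by (simp add: poisson_point_process_def)
  have lf: "locally_finite_set (\<Phi>\<^sub>l \<omega>)" if "\<omega> \<in> space M" for \<omega>
    using \<Phi> measurable_space[of \<Phi>\<^sub>l M config_space \<omega>] that
    by (simp add: poisson_point_process_def space_config_space)
  \<comment> \<open>\<open>Z\<close> carries all randomness except the marks. The event
    \<open>E n\<close> of a secure link to the \<open>n\<close>-th point splits accordingly: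
    \<open>D n\<close> concerns \<open>Z\<close> alone, and \<open>J n\<close> lists the marks that
    must be off.\<close>
  define Z where "Z \<omega> = (K \<omega>, (\<lambda>n. X n \<omega>), \<Phi>\<^sub>e \<omega>)" for \<omega>
  define D where "D n = {z \<in> space ?N. enat n < fst z \<and> norm (fst (snd z) n) < \<eta> \<and>
      snd (snd z) \<inter> ball 0 (\<beta>\<^sub>e * norm (fst (snd z) n)) = {}}" for n
  define J where "J n z = interferers \<beta>\<^sub>l (fst z) (fst (snd z)) n" for n and z :: "enat \<times> (nat \<Rightarrow> real ^ 2) \<times> (real ^ 2) set"
  define E where "E n = {\<omega> \<in> space M. Z \<omega> \<in> D n \<and> (\<forall>m\<in>J n (Z \<omega>). \<not> B m \<omega>)}" for n
  have [measurable]: "(\<lambda>z. fst (snd z) n) \<in> borel_measurable ?N" for n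
    by (rule measurable_compose[OF _ measurable_component_singleton[of n UNIV]]) measurable
  have [measurable]: "Measurable.pred ?N (\<lambda>z. snd (snd z) \<inter> ball 0 (\<beta>\<^sub>e * norm (fst (snd z) n)) = {})" for n
    by (rule pred_void_ball) measurable
  have D: "D n \<in> sets ?N" for n
    unfolding D_def by measurable
  have J: "{z \<in> space ?N. m \<in> J n z} \<in> sets ?N" for m n
    using pred_interferers[of fst ?N "\<lambda>n z. fst (snd z) n" m \<beta>\<^sub>l n] by (simp add: J_def pred_def)
  have Z [measurable]: "Z \<in> measurable M ?N"
    using BZ by (simp add: indep_elements_def Z_def[abs_def])
  have J_fin: "finite (J n (Z \<omega>))" if "\<omega> \<in> space M" "Z \<omega> \<in> D n" for n \<omega>
    using finite_interferers[OF bij[OF that(1)] _ lf[OF that(1)]] that by (simp add: J_def Z_def D_def)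
  have E: "E n \<in> events" for n
  proof -
    have [measurable]: "Measurable.pred M (\<lambda>\<omega>. m \<in> J n (Z \<omega>))" for m
      using pred_interferers[OF K X] by (simp add: J_def Z_def)
    note [measurable] = D
    show ?thesis unfolding E_def Ball_def by measurable
  qed
  have ZD: "Z \<omega> \<in> D n \<longleftrightarrow> enat n < K \<omega> \<and> norm (X n \<omega>) < \<eta> \<and> \<Phi>\<^sub>e \<omega> \<inter> ball 0 (\<beta>\<^sub>e * norm (X n \<omega>)) = {}"
    if "\<omega> \<in> space M" for \<omega> n
    using measurable_space[OF Z that] by (simp add: D_def Z_def)
  have deg: "ennreal (?deg \<omega>) = (\<Sum>n. indicator (E n) \<omega>)" if \<omega>: "\<omega> \<in> space M" for \<omega>
    unfolding secure_out_degree_enumeration[OF bij[OF \<omega>] lf[OF \<omega>] \<Phi>\<^sub>t[OF \<omega>]]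
    using \<omega> by (intro suminf_cong) (simp add: E_def ZD[unfolded Z_def] J_def Z_def indicator_def)
  have deg_nonneg: "0 \<le> ?deg \<omega>" for \<omega>
    unfolding secure_out_degree_def by (rule infsum_nonneg) simp
  have deg_meas: "?deg \<in> borel_measurable M"
  proof -
    note [measurable] = E
    \<comment> \<open>Measurability of the degree is read off from the series of indicators, without
      treating \<open>\<Phi>\<^sub>t\<close> as a random configuration.\<close>
    have "(\<lambda>\<omega>. enn2real (\<Sum>n. indicator (E n) \<omega>)) \<in> borel_measurable M" by measurable
    then show ?thesis
      by (rule measurable_cong[THEN iffD2, rotated]) (simp add: deg[symmetric] deg_nonneg)
  qed
  have "(\<integral>\<^sup>+ \<omega>. ennreal (?deg \<omega>) \<partial>M) = (\<integral>\<^sup>+ \<omega>. (\<Sum>n. indicator (E n) \<omega>) \<partial>M)"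
    by (intro nn_integral_cong deg)
  also have "\<dots> = (\<Sum>n. emeasure M (E n))"
    using E by (subst nn_integral_suminf) auto
  also have "\<dots> = (\<Sum>n. \<integral>\<^sup>+ \<omega>. indicator (D n) (Z \<omega>) * ennreal ((1 - p) ^ card (J n (Z \<omega>))) \<partial>M)"
    unfolding E_def by (intro suminf_cong emeasure_no_marks[OF B p BZ[folded Z_def] D J J_fin])
  also have "\<dots> = (\<integral>\<^sup>+ \<omega>. (\<Sum>n. indicator (D n) (Z \<omega>) * ennreal ((1 - p) ^ card (J n (Z \<omega>)))) \<partial>M)"
  proof (rule nn_integral_suminf[symmetric])
    fix n
    have [measurable]: "(\<lambda>z. card (J n z)) \<in> measurable ?N (count_space UNIV)"
      using J by (intro measurable_card) auto
    note [measurable] = D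
    show "(\<lambda>\<omega>. indicator (D n) (Z \<omega>) * ennreal ((1 - p) ^ card (J n (Z \<omega>)))) \<in> borel_measurable M"
      by measurable
  qed
  \<comment> \<open>With the marks averaged out, the series folds back into a sum over points that
    depends on the two Poisson processes only.\<close>
  also have "\<dots> = (\<integral>\<^sup>+ \<omega>. (\<Sum>x\<in>\<Phi>\<^sub>l \<omega> \<inter> ball 0 \<eta>. ennreal (link_weight \<beta>\<^sub>l \<beta>\<^sub>e (1 - p) (\<Phi>\<^sub>l \<omega>) (\<Phi>\<^sub>e \<omega>) x)) \<partial>M)"
  proof (rule nn_integral_cong)
    fix \<omega> assume \<omega>: "\<omega> \<in> space M"
    have fin: "finite (\<Phi>\<^sub>l \<omega> \<inter> ball 0 \<eta>)" by (rule finite_Int_poisson[OF \<Phi> \<omega>]) simp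
    show "(\<Sum>n. indicator (D n) (Z \<omega>) * ennreal ((1 - p) ^ card (J n (Z \<omega>)))) =
      (\<Sum>x\<in>\<Phi>\<^sub>l \<omega> \<inter> ball 0 \<eta>. ennreal (link_weight \<beta>\<^sub>l \<beta>\<^sub>e (1 - p) (\<Phi>\<^sub>l \<omega>) (\<Phi>\<^sub>e \<omega>) x))"
      unfolding sum_enumeration[OF bij[OF \<omega>] fin]
      using \<omega> by (intro suminf_cong)
        (auto simp: indicator_def ZD[unfolded Z_def] link_weight_def card_interferers[OF bij] J_def Z_def
          simp del: Int_insert_right Int_insert_right_if0 Int_insert_right_if1)
  qed
  also have "\<dots> = ennreal (lam\<^sub>l * (1 - p) * ((1 - exp (- ((lam\<^sub>l * p * \<beta>\<^sub>l\<^sup>2 + lam\<^sub>e * \<beta>\<^sub>e\<^sup>2) * pi * \<eta>\<^sup>2))) /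
      (lam\<^sub>l * p * \<beta>\<^sub>l\<^sup>2 + lam\<^sub>e * \<beta>\<^sub>e\<^sup>2)))"
  \<comment> \<open>The weight parameter is \<open>q = 1 - p\<close>, so \<open>1 - q = p\<close>
    produces the thinned density in the rate.\<close>
  proof (rule nn_integral_sum_link_weight)
    fix Q :: "(real ^ 2) set" assume Q: "Q \<in> sets borel" "Q \<subseteq> ball 0 \<eta>"
    then show "(\<lambda>\<omega>. \<Sum>x\<in>\<Phi>\<^sub>l \<omega> \<inter> Q. ennreal (link_weight \<beta>\<^sub>l \<beta>\<^sub>e (1 - p) (\<Phi>\<^sub>l \<omega>) (\<Phi>\<^sub>e \<omega>) x)) \<in> borel_measurable M"
      using finite_Int_poisson[OF \<Phi> _ bounded_subset[OF bounded_ball Q(2)]]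
      by (intro measurable_sum_link_weight[OF K X bij \<Phi>\<^sub>e]) auto
  qed (use assms in \<open>auto simp: mult_ac\<close>)
  finally have int: "(\<integral>\<^sup>+ \<omega>. ennreal (?deg \<omega>) \<partial>M) = \<dots>" .
  have "0 \<le> lam\<^sub>l * (1 - p) * ((1 - exp (- ((lam\<^sub>l * p * \<beta>\<^sub>l\<^sup>2 + lam\<^sub>e * \<beta>\<^sub>e\<^sup>2) * pi * \<eta>\<^sup>2))) /
      (lam\<^sub>l * p * \<beta>\<^sub>l\<^sup>2 + lam\<^sub>e * \<beta>\<^sub>e\<^sup>2))"
    using assms by (intro mult_nonneg_nonneg divide_nonneg_pos) auto
  with deg_meas deg_nonneg int have "has_bochner_integral M ?deg
      (lam\<^sub>l * (1 - p) * ((1 - exp (- ((lam\<^sub>l * p * \<beta>\<^sub>l\<^sup>2 + lam\<^sub>e * \<beta>\<^sub>e\<^sup>2) * pi * \<eta>\<^sup>2))) /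
      (lam\<^sub>l * p * \<beta>\<^sub>l\<^sup>2 + lam\<^sub>e * \<beta>\<^sub>e\<^sup>2)))"
    by (intro has_bochner_integral_nn_integral) auto
  then show ?thesis
    by (simp add: has_bochner_integral_iff)
qed

end
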